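(* Let $U$ be a finite set endowed with a positive partial multiplication $\cdot$, with associated prefix order $\leq_L$ and suffix order $\leq_R$. Assume that the following hold: (1) $(U,\leq_L)$ and $(U,\leq_R)$ are meet-semilattices. (2) For any $a,u,v,w\in U$ such that $a\cdot u, a\cdot v\in U$ and $w$ is the join of $u$ and $v$ for $\leq_L$, we have $a\cdot w\in U$. (3) For any $a,u,v,w\in U$ such that $u\cdot a, v\cdot a\in U$ and $w$ is the join of $u$ and $v$ for $\leq_R$, we have $w\cdot a\in U$. (4) For any $a,b,u,v\in U$ such that $a\cdot u,a\cdot v,b\cdot u,b\cdot v\in U$, either $a,b$ have a join for $\leq_R$, or $u,v$ have a join for $\leq_L$. Let $G_U$ be the group with presentation $$G_U=\langle U \mid uv=w \text{ for all } u,v,w\in U \text{ such that } u\cdot v=w\rangle .$$ Then the group $G_U\times\mathbb{Z}$ is a Garside group, with Garside element $(e,1)$.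
   Context: A positive partial multiplication on a set $U$ is a map $\cdot$ from a subset of $U\times U$ to $U$ such that: - (left associativity) if $u\cdot v$ and $(u\cdot v)\cdot w$ are defined, then $v\cdot w$ and $u\cdot(v\cdot w)$ are defined and $(u\cdot v)\cdot w=u\cdot(v\cdot w)$; - (right associativity) if $v\cdot w$ and $u\cdot(v\cdot w)$ are defined, then $u\cdot v$ and $(u\cdot v)\cdot w$ are defined and $u\cdot(v\cdot w)=(u\cdot v)\cdot w$; - (identity) there is a distinguished $e\in U$ with $e\cdot u=u\cdot e=u$ for all $u\in U$; - (positivity) if $u\cdot v=e$ then $u=v=e$; - (cancellability) $u\cdot v=u\cdot w$ implies $v=w$, and $v\cdot u=w\cdot u$ implies $v=w$. We write "$u\cdot v\in U$" for "$u\cdot v$ is defined". The orders are: $u\leq_L v$ iff there is $w\in U$ with $u\cdot w=v$; $u\leq_R v$ iff there is $w\in U$ with $w\cdot u=v$ (these are partial orders). A meet-semilattice is a poset in which every pair of elements has a meet (greatest lower bound). A join of two elements is their least upper bound, if it exists. A group $G$ is a Garside group with Garside element $\Delta\in G$ if there is a finite subset $S\subset G$ such that, denoting by $G^+$ the submonoid generated by $S$: (1) $S$ generates $G$; (2) for every $g\in G^+$ there is a bound on the length $n$ of expressions $g=s_1\cdots s_n$ with $s_i\in S\setminus\{1\}$; (3) the relations on $G^+$ given by $a\leq_L b$ iff $b\in aG^+$, and $a\leq_R b$ iff $b\in G^+a$, are lattice orders; (4) $\Delta\in G^+$ and $S=\{g\in G^+ : 1\leq_L g\leq_L\Delta\}=\{g\in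 G^+: 1\leq_R g\leq_R\Delta\}$. *)

theory Defs
  imports "HOL-Algebra.Elementary_Groups" "HOL-Algebra.Lattice"
begin

section \<open>Partial multiplications\<close>

text \<open>
  A partial map \<open>U \<times> U \<rightharpoonup> U\<close> is a function into \<^typ>\<open>'a option\<close>: \<open>m u v = Some w\<close> says that
  \<open>u \<cdot> v\<close> is defined and equal to \<open>w\<close>, and \<open>m u v = None\<close> says that \<open>u \<cdot> v\<close> is undefined.
\<close>

locale positive_partial_mult =
  fixes U :: "'a set" and m :: "'a \<Rightarrow> 'a \<Rightarrow> 'a option" and e :: 'a
  assumes closed: "m u v = Some w \<Longrightarrow> u \<in> U \<and> v \<in> U \<and> w \<in> U"
    and left_assoc: "\<lbrakk>m u v = Some x; m x w = Some z\<rbrakk> \<Longrightarrow> \<exists>y. m v w = Some y \<and> m u y = Some z"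
    and right_assoc: "\<lbrakk>m v w = Some y; m u y = Some z\<rbrakk> \<Longrightarrow> \<exists>x. m u v = Some x \<and> m x w = Some z"
    and e_in: "e \<in> U"
    and left_id: "u \<in> U \<Longrightarrow> m e u = Some u"
    and right_id: "u \<in> U \<Longrightarrow> m u e = Some u"
    and positive: "m u v = Some e \<Longrightarrow> u = e \<and> v = e"
    and left_cancel: "\<lbrakk>m u v = Some x; m u w = Some x\<rbrakk> \<Longrightarrow> v = w"
    and right_cancel: "\<lbrakk>m v u = Some x; m w u = Some x\<rbrakk> \<Longrightarrow> v = w"

definition prefix_order :: "'a set \<Rightarrow> ('a \<Rightarrow> 'a \<Rightarrow> 'a option) \<Rightarrow> 'a gorder" where
  "prefix_order U m = \<lparr>carrier = U, eq = (=), le = (\<lambda>u v. \<exists>w\<in>U. m u w = Some v)\<rparr>"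

definition suffix_order :: "'a set \<Rightarrow> ('a \<Rightarrow> 'a \<Rightarrow> 'a option) \<Rightarrow> 'a gorder" where
  "suffix_order U m = \<lparr>carrier = U, eq = (=), le = (\<lambda>u v. \<exists>w\<in>U. m w u = Some v)\<rparr>"

definition is_join :: "'a gorder \<Rightarrow> 'a \<Rightarrow> 'a \<Rightarrow> 'a \<Rightarrow> bool" where
  "is_join L u v w \<longleftrightarrow> least L w (Upper L {u, v})"


section \<open>Group presentations\<close>

text \<open>
  Words in the generators and their formal inverses: the letter \<open>(True, x)\<close> stands for \<open>x\<close> and
  \<open>(False, x)\<close> for the inverse of \<open>x\<close>. A relation \<open>(r, s)\<close> stands for the equation \<open>r = s\<close>.
\<close>

type_synonym 'a word = "(bool \<times> 'a) list"

definition words :: "'a set \<Rightarrow> 'a word set" where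
  "words X = lists (UNIV \<times> X)"

inductive_set pres_rel :: "'a set \<Rightarrow> ('a word \<times> 'a word) set \<Rightarrow> ('a word \<times> 'a word) set"
  for X R where
  refl: "a \<in> words X \<Longrightarrow> (a, a) \<in> pres_rel X R"
| sym: "(a, b) \<in> pres_rel X R \<Longrightarrow> (b, a) \<in> pres_rel X R"
| trans: "\<lbrakk>(a, b) \<in> pres_rel X R; (b, c) \<in> pres_rel X R\<rbrakk> \<Longrightarrow> (a, c) \<in> pres_rel X R"
| cancel: "\<lbrakk>a \<in> words X; b \<in> words X; x \<in> X\<rbrakk>
    \<Longrightarrow> (a @ [(s, x), (\<not> s, x)] @ b, a @ b) \<in> pres_rel X R"
| relation: "\<lbrakk>a \<in> words X; b \<in> words X; (r, s) \<in> R; r \<in> words X; s \<in> words X\<rbrakk>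
    \<Longrightarrow> (a @ r @ b, a @ s @ b) \<in> pres_rel X R"

definition presented_group :: "'a set \<Rightarrow> ('a word \<times> 'a word) set \<Rightarrow> 'a word set monoid" where
  "presented_group X R =
     \<lparr>carrier = words X // pres_rel X R,
      mult = (\<lambda>A B. \<Union>a\<in>A. \<Union>b\<in>B. pres_rel X R `` {a @ b}),
      one = pres_rel X R `` {[]}\<rparr>"

lemma pres_rel_words: "(a, b) \<in> pres_rel X R \<Longrightarrow> a \<in> words X \<and> b \<in> words X"
  by (induction rule: pres_rel.induct) (auto simp: words_def)

lemma equiv_pres_rel: "equiv (words X) (pres_rel X R)"
  by (rule equivI)
    (auto intro: refl_onI symI transI pres_rel.intros dest: pres_rel_words)

lemma pres_rel_context:
  assumes "(a, b) \<in> pres_rel X R" "p \<in> words X" "q \<in> words X"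
  shows "(p @ a @ q, p @ b @ q) \<in> pres_rel X R"
  using assms
proof (induction rule: pres_rel.induct)
  case (refl a)
  then show ?case by (intro pres_rel.refl) (auto simp: words_def)
next
  case (cancel a b x s)
  then show ?case
    using pres_rel.cancel[of "p @ a" X "b @ q" x s R] by (auto simp: words_def)
next
  case (relation a b r s)
  then show ?case
    using pres_rel.relation[of "p @ a" X "b @ q" r s R] by (auto simp: words_def)
qed (blast intro: pres_rel.intros)+

lemma pres_rel_append:
  assumes "(a, a') \<in> pres_rel X R" "(b, b') \<in> pres_rel X R"
  shows "(a @ b, a' @ b') \<in> pres_rel X R"
proof -
  have "(a @ b, a' @ b) \<in> pres_rel X R"
    using pres_rel_context[OF assms(1), of "[]" b] pres_rel_words[OF assms(2)]
    by (auto simp: words_def)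
  moreover have "(a' @ b, a' @ b') \<in> pres_rel X R"
    using pres_rel_context[OF assms(2), of a' "[]"] pres_rel_words[OF assms(1)]
    by (auto simp: words_def)
  ultimately show ?thesis by (rule pres_rel.trans)
qed

lemma presented_group_mult:
  assumes "a \<in> words X" "b \<in> words X"
  shows "pres_rel X R `` {a} \<otimes>\<^bsub>presented_group X R\<^esub> pres_rel X R `` {b} = pres_rel X R `` {a @ b}"
proof -
  have "(\<lambda>a b. pres_rel X R `` {a @ b}) respects2 pres_rel X R"
    by (intro congruent2I' equiv_class_eq[OF equiv_pres_rel] pres_rel_append)
  from UN_equiv_class2[OF equiv_pres_rel equiv_pres_rel this assms]
  show ?thesis by (simp add: presented_group_def)
qed

lemma pres_rel_inverse:
  assumes "a \<in> words X"
  shows "(rev (map (\<lambda>(s, x). (\<not> s, x)) a) @ a, []) \<in> pres_rel X R"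
  using assms
proof (induction a)
  case Nil
  then show ?case by (simp add: pres_rel.refl)
next
  case (Cons l a)
  obtain s x where l: "l = (s, x)" by (cases l)
  let ?i = "rev (map (\<lambda>(s, x). (\<not> s, x)) a)"
  have a: "a \<in> words X" and x: "x \<in> X" using Cons.prems l by (auto simp: words_def)
  have i: "?i \<in> words X" using a by (auto simp: words_def)
  have "(?i @ [(\<not> s, x), (\<not> \<not> s, x)] @ a, ?i @ a) \<in> pres_rel X R"
    by (rule pres_rel.cancel[OF i a x])
  with Cons.IH[OF a] show ?case by (auto simp: l intro: pres_rel.trans)
qed

lemma group_presented_group: "group (presented_group X R)"
proof (rule groupI)
  have one: "\<one>\<^bsub>presented_group X R\<^esub> = pres_rel X R `` {[]}" and nil: "[] \<in> words X"
    by (simp_all add: presented_group_def words_def)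
  have rep: "\<exists>a\<in>words X. A = pres_rel X R `` {a}" if "A \<in> carrier (presented_group X R)" for A
    using that by (auto simp: presented_group_def quotient_def)
  have cls: "pres_rel X R `` {a} \<in> carrier (presented_group X R)" if "a \<in> words X" for a
    using that by (auto simp: presented_group_def quotient_def)
  have app: "a @ b \<in> words X" if "a \<in> words X" "b \<in> words X" for a b
    using that by (auto simp: words_def)
  show "\<one>\<^bsub>presented_group X R\<^esub> \<in> carrier (presented_group X R)"
    using cls[OF nil] by (simp add: one)
  fix A assume A: "A \<in> carrier (presented_group X R)"
  then obtain a where a: "a \<in> words X" "A = pres_rel X R `` {a}" using rep by blast
  show "\<one>\<^bsub>presented_group X R\<^esub> \<otimes>\<^bsub>presented_group X R\<^esub> A = A"
    using a nil by (simp add: one presented_group_mult)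
  let ?i = "rev (map (\<lambda>(s, x). (\<not> s, x)) a)"
  have "?i \<in> words X" using a by (auto simp: words_def)
  moreover from this have "pres_rel X R `` {?i} \<otimes>\<^bsub>presented_group X R\<^esub> A = \<one>\<^bsub>presented_group X R\<^esub>"
    using a equiv_class_eq[OF equiv_pres_rel pres_rel_inverse[OF a(1)]]
    by (simp add: one presented_group_mult)
  ultimately show "\<exists>B\<in>carrier (presented_group X R).
      B \<otimes>\<^bsub>presented_group X R\<^esub> A = \<one>\<^bsub>presented_group X R\<^esub>"
    using cls by blast
  fix B assume B: "B \<in> carrier (presented_group X R)"
  then obtain b where b: "b \<in> words X" "B = pres_rel X R `` {b}" using rep by blast
  show "A \<otimes>\<^bsub>presented_group X R\<^esub> B \<in> carrier (presented_group X R)"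
    using a b app cls by (simp add: presented_group_mult)
  fix C assume C: "C \<in> carrier (presented_group X R)"
  then obtain c where c: "c \<in> words X" "C = pres_rel X R `` {c}" using rep by blast
  show "A \<otimes>\<^bsub>presented_group X R\<^esub> B \<otimes>\<^bsub>presented_group X R\<^esub> C =
      A \<otimes>\<^bsub>presented_group X R\<^esub> (B \<otimes>\<^bsub>presented_group X R\<^esub> C)"
    using a b c app by (simp add: presented_group_mult)
qed

definition mult_relations :: "'a set \<Rightarrow> ('a \<Rightarrow> 'a \<Rightarrow> 'a option) \<Rightarrow> ('a word \<times> 'a word) set" where
  "mult_relations U m =
     {([(True, u), (True, v)], [(True, w)]) | u v w. u \<in> U \<and> v \<in> U \<and> w \<in> U \<and> m u v = Some w}"

definition mult_group :: "'a set \<Rightarrow> ('a \<Rightarrow> 'a \<Rightarrow> 'a option) \<Rightarrow> 'a word set monoid" where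
  "mult_group U m = presented_group U (mult_relations U m)"

definition mult_group_gen :: "'a set \<Rightarrow> ('a \<Rightarrow> 'a \<Rightarrow> 'a option) \<Rightarrow> 'a \<Rightarrow> 'a word set" where
  "mult_group_gen U m u = pres_rel U (mult_relations U m) `` {[(True, u)]}"


section \<open>Garside groups\<close>

definition submonoid_generated :: "('a, 'b) monoid_scheme \<Rightarrow> 'a set \<Rightarrow> 'a set" where
  "submonoid_generated G S = \<Inter>{H. submonoid H G \<and> S \<subseteq> H}"

definition left_div_order :: "('a, 'b) monoid_scheme \<Rightarrow> 'a set \<Rightarrow> 'a gorder" where
  "left_div_order G P = \<lparr>carrier = P, eq = (=), le = (\<lambda>a b. b \<in> a <#\<^bsub>G\<^esub> P)\<rparr>"

definition right_div_order :: "('a, 'b) monoid_scheme \<Rightarrow> 'a set \<Rightarrow> 'a gorder" where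
  "right_div_order G P = \<lparr>carrier = P, eq = (=), le = (\<lambda>a b. b \<in> P #>\<^bsub>G\<^esub> a)\<rparr>"

definition garside_group :: "('a, 'b) monoid_scheme \<Rightarrow> 'a \<Rightarrow> bool" where
  "garside_group G \<Delta> \<longleftrightarrow> group G \<and> \<Delta> \<in> carrier G \<and>
     (\<exists>S. finite S \<and> S \<subseteq> carrier G \<and>
       (let P = submonoid_generated G S; L = left_div_order G P; R = right_div_order G P in
          generate G S = carrier G \<and>
          (\<forall>g\<in>P. \<exists>N. \<forall>ss. set ss \<subseteq> S - {\<one>\<^bsub>G\<^esub>} \<and> foldr (\<otimes>\<^bsub>G\<^esub>) ss \<one>\<^bsub>G\<^esub> = g \<longrightarrow> length ss \<le> N) \<and>
          lattice L \<and> lattice R \<and>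
          \<Delta> \<in> P \<and> S = \<lbrace>\<one>\<^bsub>G\<^esub>..\<Delta>\<rbrace>\<^bsub>L\<^esub> \<and> S = \<lbrace>\<one>\<^bsub>G\<^esub>..\<Delta>\<rbrace>\<^bsub>R\<^esub>))"

end

(*
Let S consist of the elements (u, 0) and (u^-1, 1) of G_U x Z for u in U, and Delta = (e, 1). The partial
multiplication of U extends to S, and conditions (1)-(4) ensure that S has meets for both orders: (2) and (3)
give the meet of (u, 0) with (v^-1, 1), and (4) decides whether the meet of (u^-1, 1) and (v^-1, 1) is the
inverse of a join or the largest w with u.w and v.w defined. Complementation
s |-> s^-1 Delta turns meets into joins.

In the monoid M presented by S, the largest prefix in S of an element, and what remains after it, are computed
letter by letter and respect the defining relations. So S embeds in M, the prefixes in S of an element are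
known, and the central element Delta can be cancelled in M. As u (u^-1 Delta) = Delta, equality of two group
words implies equality in M after multiplying by powers of Delta; hence M embeds in G_U x Z. Least common
multiples in M are assembled from joins in S, elements have finitely many divisors because a divisor of
a product of n elements of S is again such a product, and greatest common divisors follow.
*)
theory Submission
  imports Defs
begin

section \<open>Divisibility in a partial multiplication\<close>

definition pdiv :: "('a \<Rightarrow> 'a \<Rightarrow> 'a option) \<Rightarrow> 'a \<Rightarrow> 'a \<Rightarrow> bool" where
  "pdiv m x y \<longleftrightarrow> (\<exists>w. m x w = Some y)"

text \<open>Every finite subset \<open>B\<close> of \<open>A\<close> has an upper bound in
  \<open>A\<close>, by induction on \<open>B\<close>; then \<open>B\<close> is taken to be
  \<open>A\<close>. With the relation reversed this also produces least elements, and so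
  joins.\<close>

lemma directed_finite_has_greatest:
  assumes "finite A" "A \<noteq> {}"
    and directed: "\<And>x y. x \<in> A \<Longrightarrow> y \<in> A \<Longrightarrow> \<exists>z\<in>A. r x z \<and> r y z"
    and trans: "\<And>x y z. r x y \<Longrightarrow> r y z \<Longrightarrow> r x z"
  shows "\<exists>g\<in>A. \<forall>x\<in>A. r x g"
proof -
  have "\<exists>g\<in>A. \<forall>x\<in>B. r x g" if "finite B" "B \<subseteq> A" for B
    using that
  proof (induction B rule: finite_induct)
    case empty
    then show ?case using assms(2) by auto
  next
    case (insert x B)
    then obtain g where g: "g \<in> A" "\<forall>y\<in>B. r y g" by auto
    with insert directed[of x g] obtain z where "z \<in> A" "r x z" "r g z" by auto
    with g trans show ?case by blast
  qed
  with assms(1) show ?thesis by blast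
qed

context positive_partial_mult
begin

text \<open>The axioms are self-dual, and \<open>pdiv\<close> of the flipped multiplication is the
  suffix order. Interpreting a locale at the flipped multiplication thus turns each result on
  prefixes into one on suffixes.\<close>

lemma flip: "positive_partial_mult U (\<lambda>x y. m y x) e"
  apply unfold_locales
            apply (use closed in blast)
           apply (meson right_assoc)
          apply (meson left_assoc)
         apply (rule e_in)
        apply (erule right_id)
       apply (erule left_id)
      apply (use positive in blast)
     apply (erule (1) right_cancel)
    apply (erule (1) left_cancel)
  done

lemma pdiv_in: "pdiv m x y \<Longrightarrow> x \<in> U \<and> y \<in> U"
  using closed by (auto simp: pdiv_def)

lemma pdiv_refl: "x \<in> U \<Longrightarrow> pdiv m x x"
  using right_id by (auto simp: pdiv_def)

lemma pdiv_trans: "pdiv m x y \<Longrightarrow> pdiv m y z \<Longrightarrow> pdiv m x z"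
  unfolding pdiv_def using left_assoc by blast

text \<open>From \<open>x a = y\<close> and \<open>y b = x\<close> follows
  \<open>x (a b) = x\<close>; cancellation gives \<open>a b = e\<close>, and positivity gives
  \<open>a = e\<close>.\<close>

lemma pdiv_antisym: "pdiv m x y \<Longrightarrow> pdiv m y x \<Longrightarrow> x = y"
proof -
  assume "pdiv m x y" "pdiv m y x"
  then obtain a b where ab: "m x a = Some y" "m y b = Some x" by (auto simp: pdiv_def)
  then obtain c where c: "m a b = Some c" "m x c = Some x" using left_assoc by blast
  then have "c = e" using right_id left_cancel closed by blast
  with c positive have "a = e" by blast
  with ab right_id[of x] closed[OF ab(1)] show ?thesis by simp
qed

lemma e_pdiv: "x \<in> U \<Longrightarrow> pdiv m e x"
  using left_id by (auto simp: pdiv_def)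

lemma pdiv_e: "pdiv m x e \<Longrightarrow> x = e"
  using positive by (auto simp: pdiv_def)

text \<open>The same \<open>w\<close> witnesses both sides, as \<open>(a b) w = a (b w)\<close>;
  each direction takes the definedness from one of the two associativity laws.\<close>

lemma pdiv_mult_cancel:
  assumes "m a b = Some x" "m a c = Some y"
  shows "pdiv m x y \<longleftrightarrow> pdiv m b c"
proof
  assume "pdiv m x y"
  then obtain w where "m x w = Some y" by (auto simp: pdiv_def)
  with assms left_assoc obtain z where z: "m b w = Some z" "m a z = Some y" by blast
  with assms left_cancel have "z = c" by blast
  with z(1) show "pdiv m b c" by (auto simp: pdiv_def)
next
  assume "pdiv m b c"
  then obtain w where "m b w = Some c" by (auto simp: pdiv_def)
  from right_assoc[OF this assms(2)] assms(1) show "pdiv m x y" by (auto simp: pdiv_def)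
qed

end

section \<open>Garside germs and their monoids\<close>

text \<open>\<open>bar x\<close> stands for \<open>x\<inverse> \<Delta>\<close> with \<open>\<Delta>\<close> central; \<open>mult_bar\<close> says that \<open>x y = z\<close>, that is,
  \<open>x y (bar z) = \<Delta>\<close>, is invariant under cyclic permutation of \<open>x, y, bar z\<close>.\<close>

locale garside_germ = positive_partial_mult S mul one
  for S :: "'s set" and mul and one +
  fixes bar :: "'s \<Rightarrow> 's"
  assumes finite_S: "finite S"
    and bar_in: "x \<in> S \<Longrightarrow> bar x \<in> S"
    and bar_bar: "x \<in> S \<Longrightarrow> bar (bar x) = x"
    and mult_bar: "mul x y = Some z \<Longrightarrow> mul y (bar z) = Some (bar x)"
    and ex_meet: "\<lbrakk>x \<in> S; y \<in> S\<rbrakk> \<Longrightarrow>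
      \<exists>z. pdiv mul z x \<and> pdiv mul z y \<and> (\<forall>t. pdiv mul t x \<longrightarrow> pdiv mul t y \<longrightarrow> pdiv mul t z)"
    and ex_meet_flip: "\<lbrakk>x \<in> S; y \<in> S\<rbrakk> \<Longrightarrow>
      \<exists>z. pdiv (\<lambda>x y. mul y x) z x \<and> pdiv (\<lambda>x y. mul y x) z y \<and>
        (\<forall>t. pdiv (\<lambda>x y. mul y x) t x \<longrightarrow> pdiv (\<lambda>x y. mul y x) t y \<longrightarrow> pdiv (\<lambda>x y. mul y x) t z)"
begin

abbreviation le (infix "\<preceq>" 50) where "x \<preceq> y \<equiv> pdiv mul x y"

abbreviation \<Delta> where "\<Delta> \<equiv> bar one"

text \<open>Rotating twice by \<open>mult_bar\<close> is rotating once backwards. This is the form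
  that \<open>mult_bar\<close> takes in the flipped germ.\<close>

lemma bar_mult: "mul x y = Some z \<Longrightarrow> mul (bar z) x = Some (bar y)"
proof -
  assume xy: "mul x y = Some z"
  from mult_bar[OF mult_bar[OF this]] closed[OF xy] show ?thesis by (simp add: bar_bar)
qed

lemma flip_germ: "garside_germ S (\<lambda>x y. mul y x) one bar"
proof -
  interpret f: positive_partial_mult S "\<lambda>x y. mul y x" one by (rule flip)
  show ?thesis
    by unfold_locales
      (use finite_S bar_in bar_bar bar_mult ex_meet ex_meet_flip in blast)+
qed

lemma one_bar: "x \<in> S \<Longrightarrow> mul x (bar x) = Some \<Delta>"
  by (rule mult_bar[OF left_id])

lemma bar_one: "x \<in> S \<Longrightarrow> mul (bar x) x = Some \<Delta>"
  by (rule bar_mult[OF right_id])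

text \<open>Turns definedness of products into divisibility: \<open>bar s\<close> is the largest
  element that can follow \<open>s\<close>, because every simple product \<open>s t\<close> can be
  completed to \<open>\<Delta>\<close>.\<close>

lemma pdiv_bar_iff: "s \<in> S \<Longrightarrow> t \<preceq> bar s \<longleftrightarrow> (\<exists>x. mul s t = Some x)"
proof
  assume "s \<in> S" "t \<preceq> bar s"
  then obtain w where "mul t w = Some (bar s)" by (auto simp: pdiv_def)
  from right_assoc[OF this one_bar[OF \<open>s \<in> S\<close>]] show "\<exists>x. mul s t = Some x" by auto
next
  assume "\<exists>x. mul s t = Some x"
  then show "t \<preceq> bar s" using mult_bar by (auto simp: pdiv_def)
qed

text \<open>Complementation exchanges the two orders and reverses them: \<open>b\<close> is a prefix
  of \<open>a\<close> iff \<open>bar a\<close> is a suffix of \<open>bar b\<close>. The join is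
  therefore the complement of the suffix meet of the complements.\<close>

lemma ex_join:
  assumes "x \<in> S" "y \<in> S"
  shows "\<exists>z. x \<preceq> z \<and> y \<preceq> z \<and> (\<forall>t. x \<preceq> t \<longrightarrow> y \<preceq> t \<longrightarrow> z \<preceq> t)"
proof -
  let ?f = "\<lambda>x y. mul y x"
  have dual: "pdiv ?f (bar a) (bar b) \<longleftrightarrow> b \<preceq> a" if "a \<in> S" "b \<in> S" for a b
  proof
    assume "pdiv ?f (bar a) (bar b)"
    then obtain w where "mul w (bar a) = Some (bar b)" by (auto simp: pdiv_def)
    from bar_mult[OF this] that show "b \<preceq> a" by (auto simp: pdiv_def bar_bar)
  next
    assume "b \<preceq> a"
    then obtain w where "mul b w = Some a" by (auto simp: pdiv_def)
    from mult_bar[OF this] show "pdiv ?f (bar a) (bar b)" by (auto simp: pdiv_def)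
  qed
  obtain z where z: "pdiv ?f z (bar x)" "pdiv ?f z (bar y)"
    "\<And>t. pdiv ?f t (bar x) \<Longrightarrow> pdiv ?f t (bar y) \<Longrightarrow> pdiv ?f t z"
    using ex_meet_flip[OF bar_in bar_in] assms by blast
  then have zS: "z \<in> S" using closed by (auto simp: pdiv_def)
  have *: "z = bar (bar z)" "bar z \<in> S" using zS bar_bar bar_in by auto
  have "x \<preceq> bar z" "y \<preceq> bar z"
    using dual[OF *(2) assms(1)] dual[OF *(2) assms(2)] z(1,2) *(1) by simp_all
  moreover have "bar z \<preceq> t" if "x \<preceq> t" "y \<preceq> t" for t
  proof -
    have t: "t \<in> S" using that pdiv_in by blast
    have "pdiv ?f (bar t) z" using z(3) dual[OF t] assms that by blast
    with dual[OF t *(2)] *(1) show ?thesis by simp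
  qed
  ultimately show ?thesis by blast
qed

section \<open>Head and tail of a word\<close>

definition meet (infixl "\<sqinter>\<^sub>S" 70) where
  "x \<sqinter>\<^sub>S y = (SOME z. z \<preceq> x \<and> z \<preceq> y \<and> (\<forall>t. t \<preceq> x \<longrightarrow> t \<preceq> y \<longrightarrow> t \<preceq> z))"

lemma meet:
  assumes "x \<in> S" "y \<in> S"
  shows "x \<sqinter>\<^sub>S y \<preceq> x" "x \<sqinter>\<^sub>S y \<preceq> y" "\<And>t. t \<preceq> x \<Longrightarrow> t \<preceq> y \<Longrightarrow> t \<preceq> x \<sqinter>\<^sub>S y"
  using someI_ex[OF ex_meet[OF assms]] unfolding meet_def by blast+

lemma meet_in: "x \<in> S \<Longrightarrow> y \<in> S \<Longrightarrow> x \<sqinter>\<^sub>S y \<in> S"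
  using meet(1) pdiv_in by blast

definition quot where "quot x y = (THE w. mul x w = Some y)"

lemma quot_eq: "mul x w = Some y \<Longrightarrow> quot x y = w"
  unfolding quot_def by (rule the_equality) (auto intro: left_cancel)

lemma mult_quot: "x \<preceq> y \<Longrightarrow> mul x (quot x y) = Some y"
  using quot_eq by (auto simp: pdiv_def)

text \<open>\<open>absorb s h\<close> is the largest simple prefix of \<open>s \<cdot> h\<close>.\<close>

definition absorb where "absorb s h = the (mul s (bar s \<sqinter>\<^sub>S h))"

lemma absorb: "s \<in> S \<Longrightarrow> h \<in> S \<Longrightarrow> mul s (bar s \<sqinter>\<^sub>S h) = Some (absorb s h)"
  using meet(1)[OF bar_in, of s h] pdiv_bar_iff[of s "bar s \<sqinter>\<^sub>S h"] by (auto simp: absorb_def)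

lemma absorb_in: "s \<in> S \<Longrightarrow> h \<in> S \<Longrightarrow> absorb s h \<in> S"
  using absorb closed by blast

primrec head where
  "head [] = one"
| "head (s # w) = absorb s (head w)"

text \<open>\<open>tail w\<close> is what remains of \<open>w\<close> after \<open>head w\<close> is split off, see \<open>word_eq_split\<close>. Since both are
  invariants of the element represented by \<open>w\<close>, the element \<open>w\<close> can be recovered from \<open>\<Delta> w\<close>.\<close>

primrec tail where
  "tail [] = []"
| "tail (s # w) = quot (bar s \<sqinter>\<^sub>S head w) (head w) # tail w"

lemma head_in: "w \<in> lists S \<Longrightarrow> head w \<in> S"
  by (induction w) (auto simp: e_in absorb_in)

lemma quot_in: "x \<preceq> y \<Longrightarrow> quot x y \<in> S"
  using mult_quot closed by blast

lemma tail_in: "w \<in> lists S \<Longrightarrow> tail w \<in> lists S"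
  by (induction w) (auto simp: quot_in meet head_in bar_in)

lemma pdiv_head: "s \<in> S \<Longrightarrow> w \<in> lists S \<Longrightarrow> s \<preceq> head (s # w)"
  using absorb[of s "head w"] head_in by (auto simp: pdiv_def)

text \<open>Left translation by \<open>y\<close> is an order embedding that sends
  \<open>bar z\<close> to \<open>bar x\<close>, so it carries the meet of \<open>bar z\<close> and
  \<open>h\<close> to that of \<open>bar x\<close> and \<open>absorb y h\<close>. The last claim,
  that \<open>absorb\<close> is an action of the partial multiplication, makes \<open>head\<close>
  invariant; the first one controls the letters of \<open>tail\<close>.\<close>

lemma absorb_mult:
  assumes "mul x y = Some z" and h: "h \<in> S"
  shows "mul y (bar z \<sqinter>\<^sub>S h) = Some (bar x \<sqinter>\<^sub>S absorb y h)"
    and "bar z \<sqinter>\<^sub>S h \<preceq> bar y \<sqinter>\<^sub>S h"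
    and "absorb x (absorb y h) = absorb z h"
proof -
  have S: "x \<in> S" "y \<in> S" "z \<in> S" "bar x \<in> S" "bar y \<in> S" "bar z \<in> S"
    using assms closed bar_in by blast+
  let ?p = "bar z \<sqinter>\<^sub>S h" and ?q = "bar y \<sqinter>\<^sub>S h" and ?r = "bar x \<sqinter>\<^sub>S absorb y h"
  have yq: "mul y ?q = Some (absorb y h)" using absorb S h by blast
  have yz: "mul y (bar z) = Some (bar x)" using assms(1) mult_bar by blast
  have zy: "bar z \<preceq> bar y" using assms(1) bar_mult by (auto simp: pdiv_def)
  show pq: "?p \<preceq> ?q"
    using meet[OF S(6) h] meet(3)[OF S(5) h] zy pdiv_trans by blast
  obtain yp where yp: "mul y ?p = Some yp"
    using pdiv_bar_iff[OF S(2)] meet(1)[OF S(6) h] zy pdiv_trans by blast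
  have "yp \<preceq> bar x" using pdiv_mult_cancel[OF yp yz] meet(1)[OF S(6) h] by blast
  moreover have "yp \<preceq> absorb y h" using pdiv_mult_cancel[OF yp yq] pq by blast
  moreover have aS: "absorb y h \<in> S" using absorb_in S h by blast
  ultimately have 1: "yp \<preceq> ?r" using meet(3)[OF S(4) aS] by blast
  \<comment> \<open>The meet on the right is a multiple of \<open>y\<close>, since \<open>y\<close>
    is a prefix of both arguments. Dividing it by \<open>y\<close> leaves a common prefix of
    \<open>bar z\<close> and \<open>h\<close>, which gives the reverse divisibility.\<close>
  have "y \<preceq> ?r" using meet(3)[OF S(4) aS] yz yq by (auto simp: pdiv_def)
  then obtain n where n: "mul y n = Some ?r" by (auto simp: pdiv_def)
  have "n \<preceq> bar z" using pdiv_mult_cancel[OF n yz] meet(1)[OF S(4) aS] by blast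
  moreover have "n \<preceq> h"
    using pdiv_mult_cancel[OF n yq] meet(2)[OF S(4) aS] meet(2)[OF S(5) h] pdiv_trans by blast
  ultimately have "?r \<preceq> yp"
    using pdiv_mult_cancel[OF n yp] meet(3)[OF S(6) h] by blast
  with 1 have r: "?r = yp" by (rule pdiv_antisym[rotated])
  with yp show "mul y ?p = Some ?r" by simp
  have "mul x yp = Some (absorb x (absorb y h))"
    using absorb[OF S(1) aS] r by simp
  with yp assms(1) have "mul z ?p = Some (absorb x (absorb y h))"
    using right_assoc[OF yp \<open>mul x yp = _\<close>] by auto
  with absorb[OF S(3) h] show "absorb x (absorb y h) = absorb z h" by simp
qed

text \<open>Equality in the monoid presented by the germ. The rules rewrite at the front of a word
  and \<open>Cons\<close> reaches the later letters, which matches the recursion of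
  \<open>head\<close> and \<open>tail\<close>.\<close>

inductive word_eq (infix "\<approx>" 50) where
  refl: "w \<in> lists S \<Longrightarrow> w \<approx> w"
| sym: "v \<approx> w \<Longrightarrow> w \<approx> v"
| trans: "u \<approx> v \<Longrightarrow> v \<approx> w \<Longrightarrow> u \<approx> w"
| Cons: "s \<in> S \<Longrightarrow> v \<approx> w \<Longrightarrow> s # v \<approx> s # w"
| mult: "mul x y = Some z \<Longrightarrow> w \<in> lists S \<Longrightarrow> x # y # w \<approx> z # w"
| unit: "w \<in> lists S \<Longrightarrow> one # w \<approx> w"

declare word_eq.trans [trans]

lemma word_eq_in: "v \<approx> w \<Longrightarrow> v \<in> lists S \<and> w \<in> lists S"
  by (induction rule: word_eq.induct) (use closed e_in in auto)

lemma word_eq_append1: "v \<approx> w \<Longrightarrow> u \<in> lists S \<Longrightarrow> u @ v \<approx> u @ w"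
  by (induction u) (auto intro: word_eq.Cons)

lemma word_eq_append2: "v \<approx> w \<Longrightarrow> u \<in> lists S \<Longrightarrow> v @ u \<approx> w @ u"
proof (induction rule: word_eq.induct)
  case (mult x y z w)
  then show ?case using word_eq.mult[of x y z "w @ u"] by auto
next
  case (unit w)
  then show ?case using word_eq.unit[of "w @ u"] by auto
next
  case (refl w)
  then show ?case by (simp add: word_eq.refl)
qed (simp_all, (blast intro: word_eq.intros)+)

lemma absorb_one: "h \<in> S \<Longrightarrow> \<Delta> \<sqinter>\<^sub>S h = h" "h \<in> S \<Longrightarrow> absorb one h = h"
proof -
  assume h: "h \<in> S"
  have "h \<preceq> \<Delta>" using pdiv_bar_iff[OF e_in] left_id h by blast
  then show 1: "\<Delta> \<sqinter>\<^sub>S h = h"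
    using meet[OF bar_in[OF e_in] h] pdiv_refl[OF h] by (intro pdiv_antisym)
  show "absorb one h = h" using h by (simp add: absorb_def 1 left_id)
qed

text \<open>For the heads this is the action property of \<open>absorb\<close>. For the tails the
  decisive case is \<open>mult\<close>: the two letters left over from \<open>x # y\<close> multiply
  to the single letter left over from \<open>z\<close>.\<close>

lemma word_eq_head_tail: "v \<approx> w \<Longrightarrow> head v = head w \<and> tail v \<approx> tail w"
proof (induction rule: word_eq.induct)
  case (Cons s v w)
  then have "head w \<in> S" "bar s \<in> S" using word_eq_in head_in bar_in by blast+
  then have "quot (bar s \<sqinter>\<^sub>S head w) (head w) \<in> S" by (intro quot_in meet(2))
  with Cons show ?case by (auto intro: word_eq.Cons)
next
  case (mult x y z w)
  let ?h = "head w"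
  let ?p = "bar z \<sqinter>\<^sub>S ?h" and ?q = "bar y \<sqinter>\<^sub>S ?h" and ?r = "bar x \<sqinter>\<^sub>S absorb y ?h"
  have S: "x \<in> S" "y \<in> S" "z \<in> S" "bar x \<in> S" "bar y \<in> S" "bar z \<in> S" "?h \<in> S"
    using mult closed bar_in head_in by blast+
  note a = absorb_mult[OF mult(1) S(7)]
  have yq: "mul y ?q = Some (absorb y ?h)" using absorb S by blast
  have rh: "mul ?r (quot ?r (absorb y ?h)) = Some (absorb y ?h)"
    using meet(2)[OF S(4) absorb_in[OF S(2,7)]] mult_quot by blast
  \<comment> \<open>The product of \<open>?p\<close> with the first left-over letter is identified
    with \<open>?q\<close> by multiplying both with \<open>y\<close> on the left: either way the
    result is \<open>absorb y ?h\<close>.\<close>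
  obtain q' where "mul ?p (quot ?r (absorb y ?h)) = Some q'" "mul y q' = Some (absorb y ?h)"
    using left_assoc[OF a(1) rh] by blast
  then have pq: "mul ?p (quot ?r (absorb y ?h)) = Some ?q"
    using left_cancel[OF yq] by simp
  have qh: "mul ?q (quot ?q ?h) = Some ?h" using mult_quot meet(2)[OF S(5,7)] by blast
  have ph: "mul ?p (quot ?p ?h) = Some ?h" using mult_quot meet(2)[OF S(6,7)] by blast
  have "mul (quot ?r (absorb y ?h)) (quot ?q ?h) = Some (quot ?p ?h)"
  proof -
    obtain d where d: "mul (quot ?r (absorb y ?h)) (quot ?q ?h) = Some d" "mul ?p d = Some ?h"
      using left_assoc[OF pq qh] by blast
    with left_cancel[OF ph] show ?thesis by simp
  qed
  then show ?case
    using a(3) mult(2) tail_in by (auto intro: word_eq.mult)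
next
  case (unit w)
  then have h: "head w \<in> S" by (rule head_in)
  then have "quot (head w) (head w) = one" using quot_eq[OF right_id] by blast
  with h unit show ?case using word_eq.unit[OF tail_in] by (auto simp: absorb_one)
next
  case (refl w)
  then show ?case using word_eq.refl[OF tail_in] by simp
next
  case (sym v w)
  then show ?case using word_eq.sym[of "tail v" "tail w"] by simp
next
  case (trans u v w)
  then show ?case using word_eq.trans[of "tail u" "tail v" "tail w"] by simp
qed

text \<open>\<open>head w\<close> is cut into the part that \<open>s\<close> can absorb and the
  rest; the former moves into the head and the latter becomes the first letter of the tail.\<close>

lemma word_eq_split: "w \<in> lists S \<Longrightarrow> w \<approx> head w # tail w"
proof (induction w)
  case Nil
  then show ?case using word_eq.sym[OF word_eq.unit] by simp
next
  case (Cons s w)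
  then have S: "s \<in> S" "bar s \<in> S" "head w \<in> S" "w \<in> lists S" "tail w \<in> lists S"
    by (auto simp: bar_in head_in tail_in)
  let ?y = "bar s \<sqinter>\<^sub>S head w" and ?z = "quot (bar s \<sqinter>\<^sub>S head w) (head w)"
  have y: "?y \<preceq> head w" and yS: "?y \<in> S" and zS: "?z \<in> S"
    using S by (auto intro: meet(2) meet_in quot_in)
  have "s # w \<approx> s # head w # tail w" using Cons S by (auto intro: word_eq.Cons)
  also have "s # head w # tail w \<approx> s # ?y # ?z # tail w"
    using S by (intro word_eq.Cons word_eq.sym[OF word_eq.mult] mult_quot y)
  also have "s # ?y # ?z # tail w \<approx> absorb s (head w) # ?z # tail w"
    using zS S by (intro word_eq.mult absorb) auto
  finally show ?case by simp
qed

text \<open>\<open>\<Delta>\<close> absorbs nothing, as its complement is \<open>one\<close>. Hence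
  \<open>tail (\<Delta> # u)\<close> is \<open>head u # tail u\<close>, which represents the same
  element as \<open>u\<close>, and \<open>tail\<close> is invariant.\<close>

lemma word_eq_cancel_Delta:
  assumes "\<Delta> # v \<approx> \<Delta> # w"
  shows "v \<approx> w"
proof -
  have *: "tail (\<Delta> # u) \<approx> u" if u: "u \<in> lists S" for u
  proof -
    have h: "head u \<in> S" using u by (rule head_in)
    then have "one \<sqinter>\<^sub>S head u = one"
      using pdiv_e[OF meet(1)[OF e_in]] by blast
    moreover have "quot one (head u) = head u" using h left_id quot_eq by blast
    ultimately have "tail (\<Delta> # u) = head u # tail u" using e_in by (simp add: bar_bar)
    with word_eq_split[OF u] show ?thesis using word_eq.sym by simp
  qed
  have "tail (\<Delta> # v) \<approx> tail (\<Delta> # w)" using assms word_eq_head_tail by blast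
  moreover have "v \<in> lists S" "w \<in> lists S" using word_eq_in[OF assms] by auto
  ultimately show ?thesis using word_eq.trans[OF word_eq.trans[OF word_eq.sym[OF *]] *] by blast
qed

text \<open>Both sides equal \<open>s (bar s) s\<close> followed by \<open>w\<close>, because
  \<open>\<Delta>\<close> is \<open>(bar s) s\<close> as well as \<open>s (bar s)\<close>.\<close>

lemma word_eq_Delta_comm: "s \<in> S \<Longrightarrow> w \<in> lists S \<Longrightarrow> s # \<Delta> # w \<approx> \<Delta> # s # w"
proof -
  assume s: "s \<in> S" and w: "w \<in> lists S"
  have "s # \<Delta> # w \<approx> s # bar s # s # w"
    using s w bar_one by (intro word_eq.Cons word_eq.sym[OF word_eq.mult])
  also have "\<dots> \<approx> \<Delta> # s # w"
    using s w one_bar by (intro word_eq.mult) auto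
  finally show ?thesis .
qed

lemma word_eq_append_Delta: "u \<in> lists S \<Longrightarrow> w \<in> lists S \<Longrightarrow> u @ \<Delta> # w \<approx> \<Delta> # u @ w"
proof (induction u)
  case Nil
  then show ?case by (simp add: word_eq.refl e_in bar_in)
next
  case (Cons s u)
  then have "s # u @ \<Delta> # w \<approx> s # \<Delta> # u @ w" by (auto intro: word_eq.Cons)
  also have "\<dots> \<approx> \<Delta> # s # u @ w" using Cons by (intro word_eq_Delta_comm) auto
  finally show ?case by simp
qed

lemma word_eq_cancel_Deltas: "replicate n \<Delta> @ v \<approx> replicate n \<Delta> @ w \<Longrightarrow> v \<approx> w"
  by (induction n) (auto dest: word_eq_cancel_Delta)

text \<open>Each generating rule stays valid when the words are read backwards in the flipped germ.
  This carries faithfulness over to the opposite group.\<close>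

lemma word_eq_rev:
  assumes "v \<approx> w"
  shows "garside_germ.word_eq S (\<lambda>x y. mul y x) one (rev v) (rev w)"
proof -
  interpret f: garside_germ S "\<lambda>x y. mul y x" one bar by (rule flip_germ)
  from assms show ?thesis
  proof (induction rule: word_eq.induct)
    case (Cons s v w)
    then show ?case by (auto intro: f.word_eq_append2)
  next
    case (mult x y z w)
    then have "[y, x] \<in> lists S" "[z] \<in> lists S" "rev w \<in> lists S" using closed by auto
    then show ?case using f.word_eq_append1[OF f.word_eq.mult[of x y z "[]"], of "rev w"] mult by auto
  next
    case (unit w)
    then have "rev w \<in> lists S" by auto
    with f.word_eq_append1[OF f.word_eq.unit[of "[]"] this] show ?case by auto
  next
    case (refl w)
    then show ?case by (intro f.word_eq.refl) auto
  next
    case (sym v w)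
    from sym(2) show ?case by (rule f.word_eq.sym)
  next
    case (trans u v w)
    from trans(3,4) show ?case by (rule f.word_eq.trans)
  qed
qed

lemma head_single: "s \<in> S \<Longrightarrow> head [s] = s"
proof -
  assume s: "s \<in> S"
  have "bar s \<sqinter>\<^sub>S one = one" using meet(2)[OF bar_in[OF s] e_in] pdiv_e by blast
  with s show ?thesis by (simp add: absorb_def right_id)
qed

end

section \<open>Germs embedded in a group\<close>

definition opposite :: "('a, 'b) monoid_scheme \<Rightarrow> 'a monoid" where
  "opposite G = \<lparr>carrier = carrier G, monoid.mult = (\<lambda>x y. y \<otimes>\<^bsub>G\<^esub> x), one = \<one>\<^bsub>G\<^esub>\<rparr>"

lemma opposite_simps [simp]:
  "carrier (opposite G) = carrier G" "x \<otimes>\<^bsub>opposite G\<^esub> y = y \<otimes>\<^bsub>G\<^esub> x" "\<one>\<^bsub>opposite G\<^esub> = \<one>\<^bsub>G\<^esub>"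
  by (simp_all add: opposite_def)

lemma (in group) group_opposite: "group (opposite G)"
  by (rule groupI) (auto simp: m_assoc intro: r_inv_ex)

text \<open>\<open>faithful\<close> says that the monoid presented by the germ injects into the
  group. Taking it as an assumption separates the theory of divisibility from the particular group;
  \<open>letter_embedding\<close> supplies it.\<close>

locale garside_embedding = garside_germ S mul one bar + group G
  for S :: "'s set" and mul one bar and G (structure) +
  fixes \<iota> :: "'s \<Rightarrow> 'g"
  assumes \<iota>_in: "x \<in> S \<Longrightarrow> \<iota> x \<in> carrier G"
    and \<iota>_mult: "mul x y = Some z \<Longrightarrow> \<iota> z = \<iota> x \<otimes> \<iota> y"
    and faithful: "\<lbrakk>v \<in> lists S; w \<in> lists S;
      foldr (\<lambda>s g. \<iota> s \<otimes> g) v \<one> = foldr (\<lambda>s g. \<iota> s \<otimes> g) w \<one>\<rbrakk> \<Longrightarrow> v \<approx> w"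
begin

section \<open>The positive monoid and its prefix order\<close>

definition val where "val w = foldr (\<lambda>s g. \<iota> s \<otimes> g) w \<one>"

definition P where "P = val ` lists S"

definition prefix (infix "\<sqsubseteq>\<^sub>P" 50) where "a \<sqsubseteq>\<^sub>P b \<longleftrightarrow> (\<exists>c\<in>P. b = a \<otimes> c)"

lemma val_simps [simp]: "val [] = \<one>" "val (s # w) = \<iota> s \<otimes> val w"
  by (simp_all add: val_def)

lemma val_in [simp]: "w \<in> lists S \<Longrightarrow> val w \<in> carrier G"
  by (induction w) (auto simp: \<iota>_in)

lemma val_in_set [simp]: "\<forall>s\<in>set w. s \<in> S \<Longrightarrow> val w \<in> carrier G"
  by (rule val_in) auto

lemma P_in: "a \<in> P \<Longrightarrow> a \<in> carrier G"
  by (auto simp: P_def)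

lemma val_in_P: "w \<in> lists S \<Longrightarrow> val w \<in> P"
  by (simp add: P_def)

lemma \<iota>_one: "\<iota> one = \<one>"
  using \<iota>_mult[OF left_id[OF e_in]] \<iota>_in[OF e_in] by (simp add: r_cancel_one')

lemma val_append: "\<lbrakk>v \<in> lists S; w \<in> lists S\<rbrakk> \<Longrightarrow> val (v @ w) = val v \<otimes> val w"
  by (induction v) (auto simp: \<iota>_in m_assoc)

lemma word_eq_val: "v \<approx> w \<Longrightarrow> val v = val w"
proof (induction rule: word_eq.induct)
  case (mult x y z w)
  then show ?case using closed[OF mult(1)] by (simp add: \<iota>_mult[OF mult(1)] \<iota>_in m_assoc)
qed (simp_all add: \<iota>_one)

lemma val_eq_iff: "\<lbrakk>v \<in> lists S; w \<in> lists S\<rbrakk> \<Longrightarrow> val v = val w \<longleftrightarrow> v \<approx> w"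
  using faithful[of v w] word_eq_val[of v w] by (auto simp: val_def)

lemma one_in_P: "\<one> \<in> P"
  using val_in_P[of "[]"] by simp

lemma \<iota>_in_P: "s \<in> S \<Longrightarrow> \<iota> s \<in> P"
  using val_in_P[of "[s]"] by (simp add: \<iota>_in)

lemma P_mult: "a \<in> P \<Longrightarrow> b \<in> P \<Longrightarrow> a \<otimes> b \<in> P"
proof -
  assume "a \<in> P" "b \<in> P"
  then obtain v w where "v \<in> lists S" "w \<in> lists S" "a = val v" "b = val w" by (auto simp: P_def)
  then show "a \<otimes> b \<in> P" using val_append[of v w] val_in_P[of "v @ w"] by simp
qed

lemma P_induct [consumes 1, case_names one mult]:
  assumes "a \<in> P" "Q \<one>" "\<And>s a. \<lbrakk>s \<in> S; a \<in> P; Q a\<rbrakk> \<Longrightarrow> Q (\<iota> s \<otimes> a)"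
  shows "Q a"
proof -
  have "Q (val w)" if "w \<in> lists S" for w
    using that by (induction w) (auto simp: assms val_in_P)
  with assms(1) show ?thesis by (auto simp: P_def)
qed

lemma prefixI: "c \<in> P \<Longrightarrow> a \<sqsubseteq>\<^sub>P a \<otimes> c"
  by (auto simp: prefix_def)

lemma prefix_refl: "a \<in> P \<Longrightarrow> a \<sqsubseteq>\<^sub>P a"
  using one_in_P P_in by (force simp: prefix_def)

lemma prefix_trans: "a \<in> P \<Longrightarrow> a \<sqsubseteq>\<^sub>P b \<Longrightarrow> b \<sqsubseteq>\<^sub>P c \<Longrightarrow> a \<sqsubseteq>\<^sub>P c"
  unfolding prefix_def using P_mult by (auto simp: P_in m_assoc)

lemma prefix_mult_cancel:
  "\<lbrakk>a \<in> P; b \<in> P; c \<in> P\<rbrakk> \<Longrightarrow> a \<otimes> b \<sqsubseteq>\<^sub>P a \<otimes> c \<longleftrightarrow> b \<sqsubseteq>\<^sub>P c"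
  unfolding prefix_def by (auto simp: P_in m_assoc)

text \<open>By \<open>faithful\<close>, a factorisation in the group is an equality of words in the
  monoid, and \<open>head\<close> is an invariant of these. So \<open>head w\<close> gives the
  largest simple prefix.\<close>

lemma simple_prefix_iff:
  assumes "s \<in> S" "w \<in> lists S"
  shows "\<iota> s \<sqsubseteq>\<^sub>P val w \<longleftrightarrow> s \<preceq> head w"
proof
  assume "\<iota> s \<sqsubseteq>\<^sub>P val w"
  then obtain v where v: "v \<in> lists S" "val w = val (s # v)"
    by (auto simp: prefix_def P_def)
  with assms have "w \<approx> s # v" using val_eq_iff[of w "s # v"] by auto
  then have "head w = head (s # v)" using word_eq_head_tail[of w "s # v"] by simp
  then show "s \<preceq> head w" using pdiv_head[OF assms(1) v(1)] by simp
next
  assume "s \<preceq> head w"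
  then obtain r where r: "mul s r = Some (head w)" by (auto simp: pdiv_def)
  then have "r \<in> S" using closed by blast
  have "val w = \<iota> (head w) \<otimes> val (tail w)"
    using word_eq_val[OF word_eq_split[OF assms(2)]] by simp
  also have "\<dots> = \<iota> s \<otimes> (\<iota> r \<otimes> val (tail w))"
    using assms \<open>r \<in> S\<close> tail_in by (simp add: \<iota>_mult[OF r] \<iota>_in m_assoc)
  finally show "\<iota> s \<sqsubseteq>\<^sub>P val w"
    using P_mult[OF \<iota>_in_P[OF \<open>r \<in> S\<close>] val_in_P[OF tail_in[OF assms(2)]]]
    by (auto simp: prefix_def)
qed

lemma head_one: "w \<in> lists S \<Longrightarrow> s \<in> S \<Longrightarrow> \<iota> s \<otimes> val w = \<one> \<Longrightarrow> s = one"
proof -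
  assume w: "w \<in> lists S" "s \<in> S" "\<iota> s \<otimes> val w = \<one>"
  then have "s # w \<approx> []" using val_eq_iff[of "s # w" "[]"] by auto
  then have "head (s # w) = one" using word_eq_head_tail[of "s # w" "[]"] by simp
  with pdiv_head[OF w(2,1)] show "s = one" using pdiv_e by simp
qed

text \<open>Induction over the letters of \<open>a\<close>: the first letter begins a word of value
  \<open>\<one>\<close>, so it divides the head of the empty word and is trivial.\<close>

lemma P_positive:
  assumes "a \<in> P" "b \<in> P" "a \<otimes> b = \<one>"
  shows "a = \<one>"
  using assms(1,3)
proof (induction rule: P_induct)
  case one
  show ?case by simp
next
  case (mult s a)
  then have *: "\<iota> s \<otimes> (a \<otimes> b) = \<one>" using P_in assms(2) by (simp add: \<iota>_in m_assoc)
  moreover from P_mult[OF mult(2) assms(2)] obtain w where "w \<in> lists S" "a \<otimes> b = val w"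
    by (auto simp: P_def)
  ultimately have "s = one" using head_one[of w s] mult(1) by simp
  with * mult show ?case by (simp add: \<iota>_one P_in assms(2))
qed

lemma prefix_antisym:
  assumes "a \<in> P" "b \<in> P" "a \<sqsubseteq>\<^sub>P b" "b \<sqsubseteq>\<^sub>P a"
  shows "a = b"
proof -
  obtain c where c: "c \<in> P" "b = a \<otimes> c" using assms(3) by (auto simp: prefix_def)
  obtain d where d: "d \<in> P" "a = b \<otimes> d" using assms(4) by (auto simp: prefix_def)
  have carr: "a \<in> carrier G" "c \<in> carrier G" "d \<in> carrier G" using P_in assms(1) c(1) d(1) by auto
  have "a = a \<otimes> (c \<otimes> d)" using d(2) unfolding c(2) using carr by (simp only: m_assoc)
  then have "c \<otimes> d = \<one>" using carr by (simp only: l_cancel_one' m_closed)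
  then have "c = \<one>" using P_positive c(1) d(1) by blast
  with c(2) carr show ?thesis by simp
qed

text \<open>Induction over the letters of \<open>a\<close>. If \<open>u\<close> is the first one and
  the join of \<open>u\<close> and \<open>s\<close> is \<open>u s'\<close>, then the problem for
  \<open>s\<close> becomes the same problem for \<open>s'\<close> and the remaining letters.\<close>

lemma ex_lcm_simple:
  assumes "s \<in> S" "a \<in> P"
  shows "\<exists>t\<in>S. \<iota> s \<sqsubseteq>\<^sub>P a \<otimes> \<iota> t \<and> (\<forall>c\<in>P. \<iota> s \<sqsubseteq>\<^sub>P c \<longrightarrow> a \<sqsubseteq>\<^sub>P c \<longrightarrow> a \<otimes> \<iota> t \<sqsubseteq>\<^sub>P c)"
  using assms(2,1)
proof (induction arbitrary: s rule: P_induct)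
  case one
  then show ?case using prefix_refl \<iota>_in_P by (intro bexI[of _ s]) (auto simp: \<iota>_in)
next
  case (mult u a)
  obtain j where j: "u \<preceq> j" "s \<preceq> j" "\<And>t. u \<preceq> t \<Longrightarrow> s \<preceq> t \<Longrightarrow> j \<preceq> t"
    using ex_join[OF mult(1) mult(4)] by blast
  obtain s' q where s': "mul u s' = Some j" and q: "mul s q = Some j"
    using j by (auto simp: pdiv_def)
  have S: "s' \<in> S" "q \<in> S" "j \<in> S" using closed s' q by blast+
  have \<iota>j: "\<iota> j = \<iota> u \<otimes> \<iota> s'" "\<iota> j = \<iota> s \<otimes> \<iota> q" using \<iota>_mult[OF s'] \<iota>_mult[OF q] by auto
  obtain t where t: "t \<in> S" "\<iota> s' \<sqsubseteq>\<^sub>P a \<otimes> \<iota> t"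
    "\<And>c. \<lbrakk>c \<in> P; \<iota> s' \<sqsubseteq>\<^sub>P c; a \<sqsubseteq>\<^sub>P c\<rbrakk> \<Longrightarrow> a \<otimes> \<iota> t \<sqsubseteq>\<^sub>P c"
    using mult.IH[OF S(1)] by blast
  note P = \<iota>_in_P[OF mult(1)] \<iota>_in_P[OF mult(4)] \<iota>_in_P[OF S(1)] \<iota>_in_P[OF S(2)]
    \<iota>_in_P[OF S(3)] \<iota>_in_P[OF t(1)] mult(2)
  note carr = P[THEN P_in]
  have "\<iota> s \<sqsubseteq>\<^sub>P \<iota> j" using P by (simp add: \<iota>j(2) prefixI)
  moreover have "\<iota> j \<sqsubseteq>\<^sub>P \<iota> u \<otimes> (a \<otimes> \<iota> t)"
    using t(2) P by (simp add: \<iota>j(1) prefix_mult_cancel P_mult)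
  ultimately have "\<iota> s \<sqsubseteq>\<^sub>P \<iota> u \<otimes> a \<otimes> \<iota> t"
    using prefix_trans P carr by (simp add: m_assoc)
  moreover have "\<iota> u \<otimes> a \<otimes> \<iota> t \<sqsubseteq>\<^sub>P c"
    if c: "c \<in> P" and sc: "\<iota> s \<sqsubseteq>\<^sub>P c" and uac: "\<iota> u \<otimes> a \<sqsubseteq>\<^sub>P c" for c
  proof -
    obtain w where w: "w \<in> lists S" "c = val w" using c by (auto simp: P_def)
    \<comment> \<open>A common multiple \<open>c\<close> has both \<open>u\<close> and
      \<open>s\<close> below its head, hence also their join \<open>j\<close>; division by
      \<open>u\<close> leads to the induction hypothesis.\<close>
    have "\<iota> u \<sqsubseteq>\<^sub>P c" using prefix_trans[OF P(1) prefixI uac] P by blast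
    with sc have "j \<preceq> head w" using j(3) simple_prefix_iff mult(1,4) w by blast
    then have "\<iota> j \<sqsubseteq>\<^sub>P c" using simple_prefix_iff S w by blast
    then obtain d where d: "d \<in> P" "c = \<iota> j \<otimes> d" by (auto simp: prefix_def)
    then have c': "\<iota> s' \<otimes> d \<in> P" "c = \<iota> u \<otimes> (\<iota> s' \<otimes> d)"
      using P carr P_in by (auto simp: \<iota>j(1) m_assoc P_mult)
    with uac have "a \<sqsubseteq>\<^sub>P \<iota> s' \<otimes> d" using prefix_mult_cancel P by blast
    then have "a \<otimes> \<iota> t \<sqsubseteq>\<^sub>P \<iota> s' \<otimes> d" using t(3) c' d prefixI by blast
    then have "\<iota> u \<otimes> (a \<otimes> \<iota> t) \<sqsubseteq>\<^sub>P c" using prefix_mult_cancel P P_mult c' by simp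
    then show ?thesis using carr by (simp add: m_assoc)
  qed
  ultimately show ?case using t(1) by blast
qed

text \<open>A second induction, over the letters of \<open>b\<close>: the least common multiple of
  \<open>a\<close> and the first letter \<open>s\<close> is written as \<open>s x\<close>, and it
  remains to treat \<open>x\<close> and the rest of \<open>b\<close>.\<close>

lemma ex_lcm:
  assumes "a \<in> P" "b \<in> P"
  shows "\<exists>j\<in>P. a \<sqsubseteq>\<^sub>P j \<and> b \<sqsubseteq>\<^sub>P j \<and> (\<forall>c\<in>P. a \<sqsubseteq>\<^sub>P c \<longrightarrow> b \<sqsubseteq>\<^sub>P c \<longrightarrow> j \<sqsubseteq>\<^sub>P c)"
  using assms(2,1)
proof (induction arbitrary: a rule: P_induct)
  case one
  then show ?case
    using prefix_refl prefixI[of a \<one>] P_in by (intro bexI[of _ a]) auto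
next
  case (mult s b)
  obtain t where t: "t \<in> S" "\<iota> s \<sqsubseteq>\<^sub>P a \<otimes> \<iota> t"
    "\<And>c. \<lbrakk>c \<in> P; \<iota> s \<sqsubseteq>\<^sub>P c; a \<sqsubseteq>\<^sub>P c\<rbrakk> \<Longrightarrow> a \<otimes> \<iota> t \<sqsubseteq>\<^sub>P c"
    using ex_lcm_simple[OF mult(1,4)] by blast
  then obtain x where x: "x \<in> P" "a \<otimes> \<iota> t = \<iota> s \<otimes> x" by (auto simp: prefix_def)
  obtain j where j: "j \<in> P" "x \<sqsubseteq>\<^sub>P j" "b \<sqsubseteq>\<^sub>P j"
    "\<And>c. \<lbrakk>c \<in> P; x \<sqsubseteq>\<^sub>P c; b \<sqsubseteq>\<^sub>P c\<rbrakk> \<Longrightarrow> j \<sqsubseteq>\<^sub>P c"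
    using mult.IH[OF x(1)] by blast
  note P = \<iota>_in_P[OF mult(1)] \<iota>_in_P[OF t(1)] mult(2,4) x(1) j(1)
  have "a \<sqsubseteq>\<^sub>P \<iota> s \<otimes> x" using prefixI[OF P(2), of a] x by simp
  moreover have "\<iota> s \<otimes> x \<sqsubseteq>\<^sub>P \<iota> s \<otimes> j" using P j prefix_mult_cancel by blast
  ultimately have "a \<sqsubseteq>\<^sub>P \<iota> s \<otimes> j" using prefix_trans P by blast
  moreover have "\<iota> s \<otimes> b \<sqsubseteq>\<^sub>P \<iota> s \<otimes> j" using P j prefix_mult_cancel by blast
  moreover have "\<iota> s \<otimes> j \<sqsubseteq>\<^sub>P c" if c: "c \<in> P" "a \<sqsubseteq>\<^sub>P c" "\<iota> s \<otimes> b \<sqsubseteq>\<^sub>P c" for c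
  proof -
    have sc: "\<iota> s \<sqsubseteq>\<^sub>P c" using prefix_trans[OF P(1) prefixI c(3)] P by blast
    then obtain d where d: "d \<in> P" "c = \<iota> s \<otimes> d" by (auto simp: prefix_def)
    have "\<iota> s \<otimes> x \<sqsubseteq>\<^sub>P c" using t(3)[OF c(1) sc c(2)] x by simp
    then have "x \<sqsubseteq>\<^sub>P d" using prefix_mult_cancel P d by blast
    moreover have "b \<sqsubseteq>\<^sub>P d" using c prefix_mult_cancel P d by blast
    ultimately show ?thesis using j(4) d prefix_mult_cancel P by blast
  qed
  ultimately show ?case using P P_mult by blast
qed

text \<open>The word \<open>head w # tail w\<close> has one letter more than \<open>w\<close>. Here
  the total length is preserved, which is what bounds the length of divisors.\<close>

lemma val_shorten:
  assumes "w \<in> lists S" "w \<noteq> []"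
  shows "\<exists>v\<in>lists S. length w = Suc (length v) \<and> val w = \<iota> (head w) \<otimes> val v"
  using assms
proof (induction w)
  case (Cons s w)
  show ?case
  proof (cases "w = []")
    case True
    with Cons show ?thesis by (intro bexI[of _ "[]"]) (auto simp: head_single simp del: head.simps)
  next
    case False
    with Cons obtain v where v: "v \<in> lists S" "length w = Suc (length v)"
      "val w = \<iota> (head w) \<otimes> val v" by auto
    have S: "s \<in> S" "head w \<in> S" using Cons head_in by auto
    let ?y = "bar s \<sqinter>\<^sub>S head w" let ?z = "quot ?y (head w)"
    have y: "?y \<preceq> head w" using meet(2)[OF bar_in] S by blast
    have yz: "mul ?y ?z = Some (head w)" using mult_quot[OF y] .
    have sy: "mul s ?y = Some (head (s # w))" using absorb S by simp
    have S': "?y \<in> S" "?z \<in> S" "head (s # w) \<in> S" using closed[OF yz] closed[OF sy] by auto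
    have "val (s # w) = \<iota> (head (s # w)) \<otimes> val (?z # v)"
      using S S' v \<iota>_in by (simp add: \<iota>_mult[OF yz] \<iota>_mult[OF sy] m_assoc del: head.simps)
    with v S' show ?thesis by (intro bexI[of _ "?z # v"]) auto
  qed
qed auto

text \<open>With \<open>s r = head w\<close> and \<open>v\<close> one letter shorter than
  \<open>w\<close>, the quotient is \<open>r # v\<close>. An empty \<open>w\<close> forces
  \<open>s\<close> and \<open>x\<close> to be trivial.\<close>

lemma suffix_simple:
  assumes "w \<in> lists S" "s \<in> S" "x \<in> P" "val w = \<iota> s \<otimes> x"
  shows "\<exists>v\<in>lists S. length v = length w \<and> x = val v"
proof (cases "w = []")
  case True
  obtain v where v: "v \<in> lists S" "x = val v" using assms by (auto simp: P_def)
  then have "s = one" using head_one[OF v(1) assms(2)] assms True by simp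
  then have "x = \<one>" using assms True P_in \<iota>_one by simp
  with True show ?thesis by auto
next
  case False
  then obtain v where v: "v \<in> lists S" "length w = Suc (length v)" "val w = \<iota> (head w) \<otimes> val v"
    using val_shorten assms by blast
  have "\<iota> s \<sqsubseteq>\<^sub>P val w" using prefixI[OF assms(3), of "\<iota> s"] assms(4) by simp
  then have "s \<preceq> head w" using simple_prefix_iff assms by blast
  then obtain r where r: "mul s r = Some (head w)" by (auto simp: pdiv_def)
  have "r \<in> S" using closed[OF r] by simp
  have "\<iota> s \<otimes> x = \<iota> s \<otimes> (\<iota> r \<otimes> val v)"
    using v assms \<open>r \<in> S\<close> \<iota>_in \<iota>_mult[OF r] by (simp add: m_assoc)
  then have "x = val (r # v)" using v assms \<open>r \<in> S\<close> \<iota>_in P_in by simp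
  with v \<open>r \<in> S\<close> show ?thesis by (intro bexI[of _ "r # v"]) auto
qed

lemma suffix_length:
  assumes "u \<in> P" "w \<in> lists S" "x \<in> P" "val w = u \<otimes> x"
  shows "\<exists>v\<in>lists S. length v = length w \<and> x = val v"
  using assms(1,2,4)
proof (induction arbitrary: w rule: P_induct)
  case one
  with assms(3) P_in show ?case by auto
next
  case (mult s u)
  have "val w = \<iota> s \<otimes> (u \<otimes> x)" using mult assms(3) P_in \<iota>_in by (simp add: m_assoc)
  then obtain v where v: "v \<in> lists S" "length v = length w" "u \<otimes> x = val v"
    using suffix_simple[of w s "u \<otimes> x"] mult assms(3) P_mult by auto
  from mult.IH[OF v(1)] v show ?case by simp
qed

section \<open>Finiteness of divisors and bounded length\<close>

definition suffixes where "suffixes g = {x \<in> P. \<exists>u\<in>P. g = u \<otimes> x}"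

text \<open>All suffixes are values of words of one fixed length over the finite set
  \<open>S\<close>.\<close>

lemma finite_suffixes: "g \<in> P \<Longrightarrow> finite (suffixes g)"
proof -
  assume "g \<in> P"
  then obtain w where w: "w \<in> lists S" "g = val w" by (auto simp: P_def)
  have "suffixes g \<subseteq> val ` {v. set v \<subseteq> S \<and> length v = length w}"
  proof
    fix x assume "x \<in> suffixes g"
    then obtain u where "u \<in> P" "x \<in> P" "val w = u \<otimes> x" by (auto simp: suffixes_def w)
    from suffix_length[OF this(1) w(1) this(2,3)]
    show "x \<in> val ` {v. set v \<subseteq> S \<and> length v = length w}" by auto
  qed
  then show ?thesis
    using finite_lists_length_eq[OF finite_S] finite_subset by blast
qed

text \<open>\<open>\<Delta>\<close> is a word of length one, so by \<open>suffix_length\<close> each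
  suffix is one too; conversely \<open>(bar s) s = \<Delta>\<close>.\<close>

lemma suffixes_Delta: "suffixes (\<iota> \<Delta>) = \<iota> ` S"
proof
  have D: "\<Delta> \<in> S" using bar_in e_in by blast
  show "suffixes (\<iota> \<Delta>) \<subseteq> \<iota> ` S"
  proof
    fix x assume "x \<in> suffixes (\<iota> \<Delta>)"
    then obtain u where u: "u \<in> P" "x \<in> P" "\<iota> \<Delta> = u \<otimes> x" by (auto simp: suffixes_def)
    have "val [\<Delta>] = u \<otimes> x" using \<iota>_in[OF D] by (simp add: u(3)[symmetric])
    from suffix_length[OF u(1) _ u(2) this] D
    obtain v where v: "v \<in> lists S" "length v = length [\<Delta>]" "x = val v" by auto
    from v(2) obtain s where "v = [s]" by (auto simp: length_Suc_conv)
    with v show "x \<in> \<iota> ` S" by (simp add: \<iota>_in)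
  qed
  show "\<iota> ` S \<subseteq> suffixes (\<iota> \<Delta>)"
  proof
    fix x assume "x \<in> \<iota> ` S"
    then obtain s where s: "s \<in> S" "x = \<iota> s" by blast
    then show "x \<in> suffixes (\<iota> \<Delta>)"
      unfolding suffixes_def using \<iota>_mult[OF bar_one[OF s(1)]] \<iota>_in_P bar_in by blast
  qed
qed

text \<open>A nontrivial letter \<open>s\<close> strictly enlarges the set of suffixes:
  \<open>s g\<close> is new, since \<open>g = u (s g)\<close> would give \<open>u s = \<one>\<close>
  and then \<open>s = \<one>\<close> by positivity. The inequality is strict already for the empty
  product, which has the suffix \<open>\<one>\<close>.\<close>

lemma length_less_card_suffixes:
  assumes "set ss \<subseteq> \<iota> ` S - {\<one>}"
  shows "foldr (\<otimes>) ss \<one> \<in> P \<and> length ss < card (suffixes (foldr (\<otimes>) ss \<one>))"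
  using assms
proof (induction ss)
  case Nil
  have "\<one> \<in> suffixes \<one>" using one_in_P by (auto simp: suffixes_def intro!: bexI[of _ \<one>])
  with finite_suffixes[OF one_in_P] one_in_P show ?case by (auto simp: card_gt_0_iff)
next
  case (Cons s ss)
  define g where "g = foldr (\<otimes>) ss \<one>"
  have s: "s \<in> P" "s \<noteq> \<one>" using Cons \<iota>_in_P by auto
  have g: "g \<in> P" "length ss < card (suffixes g)" using Cons by (auto simp: g_def)
  note carr = P_in[OF s(1)] P_in[OF g(1)]
  have sg: "s \<otimes> g \<in> P" using s g P_mult by blast
  have "suffixes g \<subseteq> suffixes (s \<otimes> g)"
  proof
    fix x assume "x \<in> suffixes g"
    then obtain u where u: "x \<in> P" "u \<in> P" "g = u \<otimes> x" by (auto simp: suffixes_def)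
    then have "s \<otimes> g = (s \<otimes> u) \<otimes> x" using carr P_in by (simp add: m_assoc)
    with u s P_mult show "x \<in> suffixes (s \<otimes> g)" by (auto simp: suffixes_def)
  qed
  moreover have "s \<otimes> g \<in> suffixes (s \<otimes> g)"
    using one_in_P sg P_in by (auto simp: suffixes_def intro!: bexI[of _ \<one>])
  moreover have "s \<otimes> g \<notin> suffixes g"
  proof
    assume "s \<otimes> g \<in> suffixes g"
    then obtain u where u: "u \<in> P" "g = u \<otimes> (s \<otimes> g)" by (auto simp: suffixes_def)
    then have "u \<otimes> s \<otimes> g = \<one> \<otimes> g" using carr P_in[OF u(1)] by (simp add: m_assoc)
    then have *: "u \<otimes> s = \<one>" using carr P_in[OF u(1)] by (simp add: r_cancel_one)
    then have "u = \<one>" using P_positive u s by blast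
    with * carr s show False by simp
  qed
  ultimately have "card (suffixes g) < card (suffixes (s \<otimes> g))"
    using finite_suffixes[OF sg] by (intro psubset_card_mono) auto
  with g sg show ?case by (simp add: g_def)
qed

section \<open>Duality through the opposite group\<close>

lemma val_opposite: "w \<in> lists S \<Longrightarrow> foldr (\<lambda>s g. \<iota> s \<otimes>\<^bsub>opposite G\<^esub> g) w \<one>\<^bsub>opposite G\<^esub> = val (rev w)"
proof (induction w)
  case (Cons s w)
  then have "rev w \<in> lists S" "[s] \<in> lists S" by auto
  from val_append[OF this] Cons show ?case by (simp add: \<iota>_in)
qed simp

lemma flip_embedding: "garside_embedding S (\<lambda>x y. mul y x) one bar (opposite G) \<iota>"
proof -
  interpret f: garside_germ S "\<lambda>x y. mul y x" one bar by (rule flip_germ)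
  interpret o: group "opposite G" by (rule group_opposite)
  show ?thesis
  proof
    fix v w
    assume vw: "v \<in> lists S" "w \<in> lists S"
      "foldr (\<lambda>s g. \<iota> s \<otimes>\<^bsub>opposite G\<^esub> g) v \<one>\<^bsub>opposite G\<^esub> =
       foldr (\<lambda>s g. \<iota> s \<otimes>\<^bsub>opposite G\<^esub> g) w \<one>\<^bsub>opposite G\<^esub>"
    then have "val (rev v) = val (rev w)" by (simp only: val_opposite)
    moreover have "rev v \<in> lists S" "rev w \<in> lists S" using vw by auto
    ultimately have "rev v \<approx> rev w" using val_eq_iff by blast
    from word_eq_rev[OF this] show "f.word_eq v w" by simp
  qed (simp_all add: \<iota>_in \<iota>_mult)
qed

lemma P_flip: "garside_embedding.P S (opposite G) \<iota> = P"
proof -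
  interpret f: garside_embedding S "\<lambda>x y. mul y x" one bar "opposite G" \<iota> by (rule flip_embedding)
  have "f.P = (\<lambda>w. val (rev w)) ` lists S"
    unfolding f.P_def by (rule image_cong) (simp_all only: f.val_def val_opposite)
  also have "\<dots> = val ` rev ` lists S" by (simp only: image_image)
  also have "rev ` lists S = lists S"
  proof (intro equalityI subsetI)
    fix w assume "w \<in> lists S"
    then show "w \<in> rev ` lists S" by (intro image_eqI[of _ _ "rev w"]) auto
  qed auto
  finally show ?thesis by (simp only: P_def)
qed

text \<open>The common prefixes are finite in number and directed, because the least common multiple
  of two of them again divides \<open>a\<close> and \<open>b\<close>. Their greatest element is the
  gcd. Finiteness is that of the suffixes of \<open>a\<close> in the opposite group.\<close>

lemma ex_gcd:
  assumes "a \<in> P" "b \<in> P"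
  shows "\<exists>d\<in>P. d \<sqsubseteq>\<^sub>P a \<and> d \<sqsubseteq>\<^sub>P b \<and> (\<forall>c\<in>P. c \<sqsubseteq>\<^sub>P a \<longrightarrow> c \<sqsubseteq>\<^sub>P b \<longrightarrow> c \<sqsubseteq>\<^sub>P d)"
proof -
  interpret f: garside_embedding S "\<lambda>x y. mul y x" one bar "opposite G" \<iota> by (rule flip_embedding)
  define A where "A = {x \<in> P. x \<sqsubseteq>\<^sub>P a \<and> x \<sqsubseteq>\<^sub>P b}"
  have "f.suffixes a = {x \<in> P. x \<sqsubseteq>\<^sub>P a}"
    by (simp add: f.suffixes_def P_flip prefix_def)
  then have "A \<subseteq> f.suffixes a" by (auto simp: A_def)
  moreover have "finite (f.suffixes a)" using f.finite_suffixes[of a] assms(1) by (simp add: P_flip)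
  ultimately have fin: "finite A" by (rule finite_subset)
  have "\<one> \<sqsubseteq>\<^sub>P g" if "g \<in> P" for g
    using prefixI[OF that, of \<one>] P_in[OF that] by simp
  then have "\<one> \<in> A" using one_in_P assms by (simp add: A_def)
  then have ne: "A \<noteq> {}" by blast
  \<comment> \<open>Membership in \<open>P\<close> is made part of the relation so that
    \<open>prefix_trans\<close> yields an unconditional transitivity.\<close>
  have "\<exists>d\<in>A. \<forall>x\<in>A. x \<in> P \<and> x \<sqsubseteq>\<^sub>P d"
  proof (rule directed_finite_has_greatest[OF fin ne])
    fix x y assume "x \<in> A" "y \<in> A"
    then have xy: "x \<in> P" "y \<in> P" "x \<sqsubseteq>\<^sub>P a" "x \<sqsubseteq>\<^sub>P b" "y \<sqsubseteq>\<^sub>P a" "y \<sqsubseteq>\<^sub>P b"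
      by (auto simp: A_def)
    obtain j where "j \<in> P" "x \<sqsubseteq>\<^sub>P j" "y \<sqsubseteq>\<^sub>P j"
      "\<And>c. \<lbrakk>c \<in> P; x \<sqsubseteq>\<^sub>P c; y \<sqsubseteq>\<^sub>P c\<rbrakk> \<Longrightarrow> j \<sqsubseteq>\<^sub>P c"
      using ex_lcm[OF xy(1,2)] by blast
    with xy assms show "\<exists>z\<in>A. (x \<in> P \<and> x \<sqsubseteq>\<^sub>P z) \<and> (y \<in> P \<and> y \<sqsubseteq>\<^sub>P z)"
      by (intro bexI[of _ j]) (simp_all add: A_def)
  next
    fix x y z assume "x \<in> P \<and> x \<sqsubseteq>\<^sub>P y" "y \<in> P \<and> y \<sqsubseteq>\<^sub>P z"
    then show "x \<in> P \<and> x \<sqsubseteq>\<^sub>P z" using prefix_trans[of x y z] by simp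
  qed
  then obtain d where "d \<in> A" "\<And>x. x \<in> A \<Longrightarrow> x \<sqsubseteq>\<^sub>P d" by blast
  then show ?thesis unfolding A_def by (intro bexI[of _ d]) simp_all
qed

section \<open>Verification of the Garside axioms\<close>

lemma left_div_order_le: "a \<sqsubseteq>\<^bsub>left_div_order G P\<^esub> b \<longleftrightarrow> a \<sqsubseteq>\<^sub>P b"
  by (simp add: left_div_order_def prefix_def l_coset_def)

text \<open>Prefixes of \<open>\<Delta>\<close> are its suffixes in the opposite group, where
  \<open>suffixes_Delta\<close> applies.\<close>

lemma simples_eq_interval: "\<iota> ` S = \<lbrace>\<one>..\<iota> \<Delta>\<rbrace>\<^bsub>left_div_order G P\<^esub>"
proof -
  interpret f: garside_embedding S "\<lambda>x y. mul y x" one bar "opposite G" \<iota> by (rule flip_embedding)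
  have "\<one> \<sqsubseteq>\<^sub>P x" if "x \<in> P" for x
    using prefixI[OF that, of \<one>] P_in[OF that] by simp
  then have "\<lbrace>\<one>..\<iota> \<Delta>\<rbrace>\<^bsub>left_div_order G P\<^esub> = {x \<in> P. x \<sqsubseteq>\<^sub>P \<iota> \<Delta>}"
    unfolding at_least_at_most_def left_div_order_le by (auto simp: left_div_order_def)
  also have "\<dots> = f.suffixes (\<iota> \<Delta>)"
    by (simp add: f.suffixes_def P_flip prefix_def)
  finally show ?thesis using f.suffixes_Delta by simp
qed

lemma lattice_left_div_order: "lattice (left_div_order G P)"
proof -
  note le = left_div_order_le
  have carr: "carrier (left_div_order G P) = P" and eq: "(.=\<^bsub>left_div_order G P\<^esub>) = (=)"
    by (simp_all add: left_div_order_def)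
  show ?thesis
  proof unfold_locales
    fix a b assume "a \<in> carrier (left_div_order G P)" "b \<in> carrier (left_div_order G P)"
    then have ab: "a \<in> P" "b \<in> P" by (simp_all add: carr)
    show "\<exists>s. least (left_div_order G P) s (Upper (left_div_order G P) {a, b})"
      using ex_lcm[OF ab] ab by (auto simp: least_def Upper_def le carr)
    show "\<exists>s. greatest (left_div_order G P) s (Lower (left_div_order G P) {a, b})"
      using ex_gcd[OF ab] ab by (auto simp: greatest_def Lower_def le carr)
  qed (simp_all add: le carr eq, (blast intro: prefix_refl prefix_antisym prefix_trans)+)
qed

lemma submonoid_generated_simple: "submonoid_generated G (\<iota> ` S) = P"
proof
  have "submonoid P G"
    by (rule submonoid.intro) (auto simp: P_in P_mult one_in_P)
  then show "submonoid_generated G (\<iota> ` S) \<subseteq> P"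
    using \<iota>_in_P by (auto simp: submonoid_generated_def)
  show "P \<subseteq> submonoid_generated G (\<iota> ` S)"
  proof
    fix a assume a: "a \<in> P"
    have "a \<in> H" if H: "submonoid H G" "\<iota> ` S \<subseteq> H" for H
      using a H(2)
      by (induction rule: P_induct)
        (auto simp: submonoid.one_closed[OF H(1)] submonoid.m_closed[OF H(1)])
    then show "a \<in> submonoid_generated G (\<iota> ` S)" by (auto simp: submonoid_generated_def)
  qed
qed

text \<open>The conditions on right divisibility are those on left divisibility for the flipped germ
  in the opposite group, which has the same positive monoid \<open>P\<close>.\<close>

theorem garside_groupI:
  assumes "generate G (\<iota> ` S) = carrier G"
  shows "garside_group G (\<iota> \<Delta>)"
proof -
  interpret f: garside_embedding S "\<lambda>x y. mul y x" one bar "opposite G" \<iota> by (rule flip_embedding)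
  have D: "\<Delta> \<in> S" using bar_in e_in by blast
  have R: "right_div_order G P = left_div_order (opposite G) P"
    by (simp add: right_div_order_def left_div_order_def l_coset_def r_coset_def)
  have right: "lattice (right_div_order G P)" "\<iota> ` S = \<lbrace>\<one>..\<iota> \<Delta>\<rbrace>\<^bsub>right_div_order G P\<^esub>"
    using f.lattice_left_div_order f.simples_eq_interval unfolding R P_flip by simp_all
  have bound: "\<exists>N. \<forall>ss. set ss \<subseteq> \<iota> ` S - {\<one>} \<and> foldr (\<otimes>) ss \<one> = g \<longrightarrow> length ss \<le> N" for g
    using length_less_card_suffixes by (intro exI[of _ "card (suffixes g)"]) (auto intro: less_imp_le)
  have fin: "finite (\<iota> ` S)" and sub: "\<iota> ` S \<subseteq> carrier G" using finite_S \<iota>_in by auto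
  show ?thesis
    unfolding garside_group_def Let_def
    by (intro conjI exI[of _ "\<iota> ` S"] ballI, unfold submonoid_generated_simple)
      (rule group_axioms \<iota>_in[OF D] fin sub assms bound lattice_left_div_order right(1)
        \<iota>_in_P[OF D] simples_eq_interval right(2))+
qed

end

section \<open>The germ of an interlocked partial multiplication\<close>

definition pjoin :: "('a \<Rightarrow> 'a \<Rightarrow> 'a option) \<Rightarrow> 'a \<Rightarrow> 'a \<Rightarrow> 'a \<Rightarrow> bool" where
  "pjoin m u v w \<longleftrightarrow> pdiv m u w \<and> pdiv m v w \<and> (\<forall>t. pdiv m u t \<longrightarrow> pdiv m v t \<longrightarrow> pdiv m w t)"

text \<open>The partial quotient \<open>u\<inverse> v\<close>; for the flipped multiplication it is
  \<open>v u\<inverse>\<close>.\<close>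

definition pquot :: "('a \<Rightarrow> 'a \<Rightarrow> 'a option) \<Rightarrow> 'a \<Rightarrow> 'a \<Rightarrow> 'a option" where
  "pquot m u v = (if \<exists>w. m u w = Some v then Some (THE w. m u w = Some v) else None)"

text \<open>The pair \<open>(True, u)\<close> encodes the element \<open>(u, 0)\<close> of \<open>G\<^sub>U \<times> \<int>\<close> and \<open>(False, u)\<close> encodes \<open>(u\<inverse>, 1)\<close>.
  For instance \<open>u v\<inverse> = w\<inverse>\<close> holds when \<open>w u = v\<close>. The encoding matches the letters of \<open>'a word\<close>, so that a
  word over the germ is literally a group word.\<close>

fun smul :: "('a \<Rightarrow> 'a \<Rightarrow> 'a option) \<Rightarrow> bool \<times> 'a \<Rightarrow> bool \<times> 'a \<Rightarrow> (bool \<times> 'a) option" where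
  "smul m (True, u) (True, v) = map_option (Pair True) (m u v)"
| "smul m (True, u) (False, v) = map_option (Pair False) (pquot (\<lambda>x y. m y x) u v)"
| "smul m (False, u) (True, v) = map_option (Pair False) (pquot m v u)"
| "smul m (False, u) (False, v) = None"

text \<open>Both \<open>(u, 0)\<inverse> \<Delta> = (u\<inverse>, 1)\<close> and
  \<open>(u\<inverse>, 1)\<inverse> \<Delta> = (u, 0)\<close> hold for
  \<open>\<Delta> = (e, 1)\<close>, so complementation is formal inversion of letters.\<close>

definition sbar :: "bool \<times> 'a \<Rightarrow> bool \<times> 'a" where
  "sbar x = (\<not> fst x, snd x)"

lemma smul_flip: "smul (\<lambda>x y. m y x) x y = smul m y x"
  by (cases x; cases y; cases "fst x"; cases "fst y") auto

declare smul.simps(1-3) [simp del]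

section \<open>The signed elements as a positive partial multiplication\<close>

context positive_partial_mult
begin

lemma pquot_iff: "pquot m u v = Some w \<longleftrightarrow> m u w = Some v"
proof
  assume "m u w = Some v"
  moreover from this have "(THE w. m u w = Some v) = w"
    using left_cancel by (intro the_equality) auto
  ultimately show "pquot m u v = Some w" by (auto simp: pquot_def)
next
  assume "pquot m u v = Some w"
  then obtain w' where w': "m u w' = Some v" "w = (THE w. m u w = Some v)"
    by (auto simp: pquot_def split: if_splits)
  moreover from this have "(THE w. m u w = Some v) = w'"
    using left_cancel by (intro the_equality) auto
  ultimately show "m u w = Some v" by simp
qed

lemma pquot_flip_iff: "pquot (\<lambda>x y. m y x) u v = Some w \<longleftrightarrow> m w u = Some v"
  by (rule positive_partial_mult.pquot_iff[OF flip])

lemma smul_iff: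
  "smul m (True, u) (True, v) = Some (s, w) \<longleftrightarrow> s \<and> m u v = Some w"
  "smul m (True, u) (False, v) = Some (s, w) \<longleftrightarrow> \<not> s \<and> m w u = Some v"
  "smul m (False, u) (True, v) = Some (s, w) \<longleftrightarrow> \<not> s \<and> m v w = Some u"
  using pquot_iff[of v u w] pquot_flip_iff[of u v w] by (auto simp: smul.simps)

text \<open>At most one of the three factors is negative, since a product of two negative elements
  is undefined. In each of the four cases, clearing the inverses leaves one of the associativity
  laws of \<open>m\<close>.\<close>

lemma smul_left_assoc:
  assumes "smul m x y = Some p" "smul m p w = Some z"
  shows "\<exists>q. smul m y w = Some q \<and> smul m x q = Some z"
proof -
  obtain a b c s t r where x: "x = (s, a)" "y = (t, b)" "w = (r, c)" by (metis surj_pair)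
  obtain i p' j z' where p: "p = (i, p')" "z = (j, z')" by (metis surj_pair)
  consider "s" "t" "r" | "s" "t" "\<not> r" | "s" "\<not> t" "r" | "\<not> s" "t" "r"
    using assms x p by (cases s; cases t; cases r; cases i) (auto simp: smul_iff)
  then show ?thesis
  proof cases
    case 1
    with assms x p have "m a b = Some p'" "m p' c = Some z'" "j" "i" by (auto simp: smul_iff)
    moreover from left_assoc[OF this(1,2)] obtain q where "m b c = Some q" "m a q = Some z'" by blast
    ultimately show ?thesis using 1 x p by (intro exI[of _ "(True, q)"]) (auto simp: smul_iff)
  next
    case 2
    with assms x p have "m a b = Some p'" "m z' p' = Some c" "\<not> j" "i" by (auto simp: smul_iff)
    moreover from right_assoc[OF this(1,2)] obtain q where "m z' a = Some q" "m q b = Some c" by blast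
    ultimately show ?thesis using 2 x p by (intro exI[of _ "(False, q)"]) (auto simp: smul_iff)
  next
    case 3
    with assms x p have "m c z' = Some p'" "m p' a = Some b" "\<not> j" "\<not> i" by (auto simp: smul_iff)
    moreover from left_assoc[OF this(1,2)] obtain q where "m z' a = Some q" "m c q = Some b" by blast
    ultimately show ?thesis using 3 x p by (intro exI[of _ "(False, q)"]) (auto simp: smul_iff)
  next
    case 4
    with assms x p have "m c z' = Some p'" "m b p' = Some a" "\<not> j" "\<not> i" by (auto simp: smul_iff)
    moreover from right_assoc[OF this(1,2)] obtain q where "m b c = Some q" "m q z' = Some a" by blast
    ultimately show ?thesis using 4 x p by (intro exI[of _ "(True, q)"]) (auto simp: smul_iff)
  qed
qed

lemma smul_left_cancel:
  assumes "smul m x y = Some p" "smul m x z = Some p"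
  shows "y = z"
proof -
  obtain s a t b r c i p' where x: "x = (s, a)" "y = (t, b)" "z = (r, c)" "p = (i, p')"
    by (metis surj_pair)
  show ?thesis
    using assms unfolding x
    by (cases s; cases t; cases r) (auto simp: smul_iff dest: left_cancel right_cancel)
qed

lemma smul_closed:
  assumes "smul m x y = Some z"
  shows "x \<in> UNIV \<times> U \<and> y \<in> UNIV \<times> U \<and> z \<in> UNIV \<times> U"
proof -
  obtain s a t b i c where x: "x = (s, a)" "y = (t, b)" "z = (i, c)" by (metis surj_pair)
  show ?thesis
    using assms unfolding x by (cases s; cases t) (auto simp: smul_iff dest: closed)
qed

lemma smul_left_id: "x \<in> UNIV \<times> U \<Longrightarrow> smul m (True, e) x = Some x"
  by (cases x; cases "fst x") (auto simp: smul_iff left_id right_id)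

lemma smul_positive: "smul m x y = Some (True, e) \<Longrightarrow> x = (True, e)"
  using positive by (cases x; cases y; cases "fst x"; cases "fst y") (auto simp: smul_iff)

lemma smul_sbar: "smul m x y = Some z \<Longrightarrow> smul m y (sbar z) = Some (sbar x)"
  by (cases x; cases y; cases z; cases "fst x"; cases "fst y")
    (auto simp: smul_iff sbar_def)

text \<open>Reduces meets of signed elements to questions about \<open>m\<close>. In the mixed case,
  \<open>u z\<inverse> = v\<inverse>\<close> means \<open>v u = z\<close>; the order of negative
  elements is reversed by inversion.\<close>

lemma pdiv_smul:
  "pdiv (smul m) (True, u) (True, v) \<longleftrightarrow> pdiv m u v"
  "pdiv (smul m) (True, u) (False, v) \<longleftrightarrow> (\<exists>z. m v u = Some z)"
  "pdiv (smul m) (False, u) (False, v) \<longleftrightarrow> pdiv (\<lambda>x y. m y x) v u"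
  "\<not> pdiv (smul m) (False, u) (True, v)"
  unfolding pdiv_def split_paired_Ex ex_bool_eq
  by (auto simp: smul_iff)

end

text \<open>By \<open>smul_flip\<close>, the right-hand axioms are the left-hand ones for the
  flipped \<open>m\<close>.\<close>

lemma (in positive_partial_mult) smul_positive_partial_mult:
  "positive_partial_mult (UNIV \<times> U) (smul m) (True, e)"
proof -
  interpret f: positive_partial_mult U "\<lambda>x y. m y x" e by (rule flip)
  show ?thesis
  proof
    show "\<And>u v w. smul m u v = Some w \<Longrightarrow> u \<in> UNIV \<times> U \<and> v \<in> UNIV \<times> U \<and> w \<in> UNIV \<times> U"
      by (rule smul_closed)
    show "\<And>u v x w z. \<lbrakk>smul m u v = Some x; smul m x w = Some z\<rbrakk> \<Longrightarrow>
        \<exists>y. smul m v w = Some y \<and> smul m u y = Some z"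
      by (rule smul_left_assoc)
    show "\<And>v w y u z. \<lbrakk>smul m v w = Some y; smul m u y = Some z\<rbrakk> \<Longrightarrow>
        \<exists>x. smul m u v = Some x \<and> smul m x w = Some z"
      using f.smul_left_assoc unfolding smul_flip[of m] by blast
    show "(True, e) \<in> UNIV \<times> U" using e_in by simp
    show "\<And>u. u \<in> UNIV \<times> U \<Longrightarrow> smul m (True, e) u = Some u" by (rule smul_left_id)
    show "\<And>u. u \<in> UNIV \<times> U \<Longrightarrow> smul m u (True, e) = Some u"
      using f.smul_left_id unfolding smul_flip[of m] by blast
    show "\<And>u v. smul m u v = Some (True, e) \<Longrightarrow> u = (True, e) \<and> v = (True, e)"
      using smul_positive f.smul_positive unfolding smul_flip[of m] by blast
    show "\<And>u v x w. \<lbrakk>smul m u v = Some x; smul m u w = Some x\<rbrakk> \<Longrightarrow> v = w"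
      by (rule smul_left_cancel)
    show "\<And>v u x w. \<lbrakk>smul m v u = Some x; smul m w u = Some x\<rbrakk> \<Longrightarrow> v = w"
      using f.smul_left_cancel unfolding smul_flip[of m] by blast
  qed
qed

text \<open>The hypotheses on \<open>U\<close>, stated with \<open>pdiv\<close> and
  \<open>pjoin\<close> so that flipping \<open>m\<close> exchanges \<open>mult_join\<close> with
  \<open>join_mult\<close> and leaves \<open>interlock\<close> in the same form.\<close>

locale interlocked_partial_mult = positive_partial_mult U m e
  for U :: "'a set" and m and e +
  assumes finite_U: "finite U"
    and ex_meet: "\<lbrakk>x \<in> U; y \<in> U\<rbrakk> \<Longrightarrow>
      \<exists>z. pdiv m z x \<and> pdiv m z y \<and> (\<forall>t. pdiv m t x \<longrightarrow> pdiv m t y \<longrightarrow> pdiv m t z)"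
    and ex_meet_flip: "\<lbrakk>x \<in> U; y \<in> U\<rbrakk> \<Longrightarrow>
      \<exists>z. pdiv (\<lambda>x y. m y x) z x \<and> pdiv (\<lambda>x y. m y x) z y \<and>
        (\<forall>t. pdiv (\<lambda>x y. m y x) t x \<longrightarrow> pdiv (\<lambda>x y. m y x) t y \<longrightarrow> pdiv (\<lambda>x y. m y x) t z)"
    and mult_join: "\<lbrakk>m a u \<noteq> None; m a v \<noteq> None; pjoin m u v w\<rbrakk> \<Longrightarrow> m a w \<noteq> None"
    and join_mult: "\<lbrakk>m u a \<noteq> None; m v a \<noteq> None; pjoin (\<lambda>x y. m y x) u v w\<rbrakk> \<Longrightarrow> m w a \<noteq> None"
    and interlock: "\<lbrakk>m a u \<noteq> None; m a v \<noteq> None; m b u \<noteq> None; m b v \<noteq> None\<rbrakk> \<Longrightarrow>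
      (\<exists>w. pjoin (\<lambda>x y. m y x) a b w) \<or> (\<exists>w. pjoin m u v w)"
begin

lemma flip_interlocked: "interlocked_partial_mult U (\<lambda>x y. m y x) e"
proof -
  interpret f: positive_partial_mult U "\<lambda>x y. m y x" e by (rule flip)
  show ?thesis
  proof
    fix a b u v
    assume "m u a \<noteq> None" "m v a \<noteq> None" "m u b \<noteq> None" "m v b \<noteq> None"
    then show "(\<exists>w. pjoin m a b w) \<or> (\<exists>w. pjoin (\<lambda>x y. m y x) u v w)"
      using interlock[of u a b v] by blast
  next
    fix a u v w
    show "\<lbrakk>m u a \<noteq> None; m v a \<noteq> None; pjoin (\<lambda>x y. m y x) u v w\<rbrakk> \<Longrightarrow> m w a \<noteq> None"
      by (rule join_mult)
    show "\<lbrakk>m a u \<noteq> None; m a v \<noteq> None; pjoin m u v w\<rbrakk> \<Longrightarrow> m a w \<noteq> None"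
      by (rule mult_join)
  qed (rule finite_U ex_meet ex_meet_flip; assumption?)+
qed

text \<open>The common upper bounds form a finite nonempty set that meets make directed downwards;
  its least element is the join.\<close>

lemma bounded_join:
  assumes "pdiv m u x" "pdiv m v x"
  shows "\<exists>w. pjoin m u v w"
proof -
  let ?A = "{z. pdiv m u z \<and> pdiv m v z}"
  have "?A \<subseteq> U" using pdiv_in by blast
  then have fin: "finite ?A" using finite_U by (rule finite_subset)
  have "\<exists>g\<in>?A. \<forall>z\<in>?A. pdiv m g z"
  proof (rule directed_finite_has_greatest[OF fin])
    show "?A \<noteq> {}" using assms by blast
    fix x y assume xy: "x \<in> ?A" "y \<in> ?A"
    then have "x \<in> U" "y \<in> U" using pdiv_in by blast+
    from ex_meet[OF this] xy show "\<exists>z\<in>?A. pdiv m z x \<and> pdiv m z y" by blast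
  next
    fix x y z assume "pdiv m y x" "pdiv m z y"
    then show "pdiv m z x" using pdiv_trans by blast
  qed
  then show ?thesis by (auto simp: pjoin_def)
qed

lemma ex_greatest:
  assumes "e \<in> A" "A \<subseteq> U"
    and join: "\<And>x y. x \<in> A \<Longrightarrow> y \<in> A \<Longrightarrow> \<exists>z\<in>A. pjoin m x y z"
  shows "\<exists>g\<in>A. \<forall>x\<in>A. pdiv m x g"
proof (rule directed_finite_has_greatest)
  show "finite A" using assms(2) finite_U by (rule finite_subset)
  show "A \<noteq> {}" using assms(1) by blast
  show "\<exists>z\<in>A. pdiv m x z \<and> pdiv m y z" if "x \<in> A" "y \<in> A" for x y
    using join[OF that] by (auto simp: pjoin_def)
qed (rule pdiv_trans)

text \<open>By signs: two positive elements have their meet in \<open>U\<close>; a mixed pair has a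
  positive meet; two negative elements have a negative meet if \<open>u\<close> and \<open>v\<close>
  have a suffix join, and a positive one otherwise.\<close>

lemma smul_ex_meet:
  assumes "x \<in> UNIV \<times> U" "y \<in> UNIV \<times> U"
  shows "\<exists>z. pdiv (smul m) z x \<and> pdiv (smul m) z y \<and>
    (\<forall>t. pdiv (smul m) t x \<longrightarrow> pdiv (smul m) t y \<longrightarrow> pdiv (smul m) t z)"
proof -
  interpret f: interlocked_partial_mult U "\<lambda>x y. m y x" e by (rule flip_interlocked)
  have mixed: "\<exists>z. pdiv (smul m) z (True, u) \<and> pdiv (smul m) z (False, v) \<and>
    (\<forall>t. pdiv (smul m) t (True, u) \<longrightarrow> pdiv (smul m) t (False, v) \<longrightarrow> pdiv (smul m) t z)"
    if uv: "u \<in> U" "v \<in> U" for u v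
  proof -
    \<comment> \<open>These are the common divisors of the mixed pair. Joins exist since
      \<open>u\<close> bounds them, and \<open>mult_join\<close> keeps them in the set.\<close>
    let ?A = "{w. pdiv m w u \<and> m v w \<noteq> None}"
    have "\<exists>g\<in>?A. \<forall>x\<in>?A. pdiv m x g"
    proof (rule ex_greatest)
      show "e \<in> ?A" using uv e_pdiv right_id by auto
      show "?A \<subseteq> U" using pdiv_in by blast
      fix x y assume xy: "x \<in> ?A" "y \<in> ?A"
      then obtain j where j: "pjoin m x y j" using bounded_join[of x u y] by auto
      then have "pdiv m j u" using xy by (auto simp: pjoin_def)
      moreover have "m v j \<noteq> None" using mult_join[OF _ _ j] xy by blast
      ultimately show "\<exists>z\<in>?A. pjoin m x y z" using j by blast
    qed
    then obtain g where g: "g \<in> ?A" "\<And>x. x \<in> ?A \<Longrightarrow> pdiv m x g" by blast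
    show ?thesis
    proof (intro exI[of _ "(True, g)"] conjI allI impI)
      show "pdiv (smul m) (True, g) (True, u)" "pdiv (smul m) (True, g) (False, v)"
        using g(1) by (auto simp: pdiv_smul)
      fix t assume "pdiv (smul m) t (True, u)" "pdiv (smul m) t (False, v)"
      then show "pdiv (smul m) t (True, g)"
        using g(2) by (cases t; cases "fst t") (auto simp: pdiv_smul)
    qed
  qed
  obtain s u r v where xy: "x = (s, u)" "y = (r, v)" "u \<in> U" "v \<in> U" using assms by blast
  consider "s" "r" | "s" "\<not> r" | "\<not> s" "r" | "\<not> s" "\<not> r" by blast
  then show ?thesis
  proof cases
    case 1
    obtain z where z: "pdiv m z u" "pdiv m z v" "\<And>t. pdiv m t u \<Longrightarrow> pdiv m t v \<Longrightarrow> pdiv m t z"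
      using ex_meet[OF xy(3,4)] by blast
    show ?thesis
    proof (intro exI[of _ "(True, z)"] conjI allI impI)
      show "pdiv (smul m) (True, z) x" "pdiv (smul m) (True, z) y"
        using 1 xy z by (simp_all add: pdiv_smul)
      fix t assume "pdiv (smul m) t x" "pdiv (smul m) t y"
      then show "pdiv (smul m) t (True, z)"
        using z(3) 1 xy by (cases t; cases "fst t") (auto simp: pdiv_smul)
    qed
  next
    case 2
    with mixed[OF xy(3,4)] xy show ?thesis by simp
  next
    case 3
    with mixed[OF xy(4,3)] xy show ?thesis by (simp add: conj_commute) blast
  next
    case 4
    show ?thesis
    proof (cases "\<exists>w. pjoin (\<lambda>x y. m y x) u v w")
      case True
      then obtain w where w: "pjoin (\<lambda>x y. m y x) u v w" by blast
      show ?thesis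
      proof (intro exI[of _ "(False, w)"] conjI allI impI)
        show "pdiv (smul m) (False, w) x" "pdiv (smul m) (False, w) y"
          using 4 xy w by (simp_all add: pdiv_smul pjoin_def)
        fix t assume t: "pdiv (smul m) t x" "pdiv (smul m) t y"
        obtain i a where ia: "t = (i, a)" by (cases t)
        show "pdiv (smul m) t (False, w)"
        proof (cases i)
          case True
          then have "m u a \<noteq> None" "m v a \<noteq> None" using t 4 xy ia by (auto simp: pdiv_smul)
          \<comment> \<open>For a positive common divisor \<open>a\<close>, \<open>join_mult\<close>
            makes \<open>w a\<close> defined, so \<open>a\<close> divides
            \<open>(False, w)\<close>.\<close>
          from join_mult[OF this w] show ?thesis using True ia by (auto simp: pdiv_smul)
        next
          case False
          then show ?thesis using t 4 xy ia w by (auto simp: pdiv_smul pjoin_def)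
        qed
      qed
    next
      case False
      let ?A = "{w. m u w \<noteq> None \<and> m v w \<noteq> None}"
      have "\<exists>g\<in>?A. \<forall>x\<in>?A. pdiv m x g"
      proof (rule ex_greatest)
        show "e \<in> ?A" using xy right_id by auto
        show "?A \<subseteq> U" using closed by blast
        fix a b assume ab: "a \<in> ?A" "b \<in> ?A"
        \<comment> \<open>Without a suffix join of \<open>u\<close> and \<open>v\<close>, the
          interlocking condition leaves only a prefix join of \<open>a\<close> and
          \<open>b\<close>.\<close>
        then obtain j where j: "pjoin m a b j" using interlock[of u a b v] False by blast
        have "m u j \<noteq> None" "m v j \<noteq> None" using mult_join[OF _ _ j] ab by blast+
        then show "\<exists>z\<in>?A. pjoin m a b z" using j by blast
      qed
      then obtain g where g: "g \<in> ?A" "\<And>x. x \<in> ?A \<Longrightarrow> pdiv m x g" by blast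
      show ?thesis
      proof (intro exI[of _ "(True, g)"] conjI allI impI)
        show "pdiv (smul m) (True, g) x" "pdiv (smul m) (True, g) y"
          using g(1) 4 xy by (auto simp: pdiv_smul)
        fix t assume t: "pdiv (smul m) t x" "pdiv (smul m) t y"
        obtain i a where ia: "t = (i, a)" by (cases t)
        \<comment> \<open>A negative common divisor would have both \<open>u\<close> and
          \<open>v\<close> as suffixes, which by \<open>bounded_join\<close> would give them a
          suffix join.\<close>
        have "i"
        proof (rule ccontr)
          assume "\<not> i"
          then have "pdiv (\<lambda>x y. m y x) u a" "pdiv (\<lambda>x y. m y x) v a"
            using t 4 xy ia by (simp_all add: pdiv_smul)
          with f.bounded_join False show False by blast
        qed
        then show "pdiv (smul m) t (True, g)"
          using g(2) t 4 xy ia by (auto simp: pdiv_smul)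
      qed
    qed
  qed
qed

end

lemma (in interlocked_partial_mult) smul_germ:
  "garside_germ (UNIV \<times> U) (smul m) (True, e) sbar"
proof -
  interpret f: interlocked_partial_mult U "\<lambda>x y. m y x" e by (rule flip_interlocked)
  interpret s: positive_partial_mult "UNIV \<times> U" "smul m" "(True, e)"
    by (rule smul_positive_partial_mult)
  have flip: "(\<lambda>x y. smul m y x) = smul (\<lambda>x y. m y x)" by (intro ext) (simp add: smul_flip[of m])
  show ?thesis
  proof
    show "finite ((UNIV :: bool set) \<times> U)" using finite_U by simp
    show "\<And>x. x \<in> UNIV \<times> U \<Longrightarrow> sbar x \<in> UNIV \<times> U" "\<And>x. x \<in> UNIV \<times> U \<Longrightarrow> sbar (sbar x) = x"
      by (auto simp: sbar_def)
    show "\<And>x y z. smul m x y = Some z \<Longrightarrow> smul m y (sbar z) = Some (sbar x)"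
      by (rule smul_sbar)
  next
    fix x y assume xy: "x \<in> (UNIV :: bool set) \<times> U" "y \<in> (UNIV :: bool set) \<times> U"
    show "\<exists>z. pdiv (smul m) z x \<and> pdiv (smul m) z y \<and>
        (\<forall>t. pdiv (smul m) t x \<longrightarrow> pdiv (smul m) t y \<longrightarrow> pdiv (smul m) t z)"
      using xy by (rule smul_ex_meet)
    show "\<exists>z. pdiv (\<lambda>x y. smul m y x) z x \<and> pdiv (\<lambda>x y. smul m y x) z y \<and>
        (\<forall>t. pdiv (\<lambda>x y. smul m y x) t x \<longrightarrow> pdiv (\<lambda>x y. smul m y x) t y \<longrightarrow>
          pdiv (\<lambda>x y. smul m y x) t z)"
      unfolding flip using xy by (rule f.smul_ex_meet)
  qed
qed

section \<open>The germ embeds in the group\<close>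

context interlocked_partial_mult
begin

abbreviation "R \<equiv> mult_relations U m"

text \<open>The integer coordinate of the product of the signed letters, see
  \<open>letter_val\<close>.\<close>

definition neg where "neg w = length (filter (\<lambda>x. \<not> fst x) w)"

lemma neg_simps [simp]:
  "neg [] = 0" "neg ((s, u) # w) = (if s then neg w else Suc (neg w))" "neg (v @ w) = neg v + neg w"
  by (simp_all add: neg_def)

interpretation g: garside_germ "UNIV \<times> U" "smul m" "(True, e)" sbar
  by (rule smul_germ)

text \<open>A group word \<open>w\<close> read as a word over \<open>UNIV \<times> U\<close> has the value \<open>w \<Delta>\<^bsup>neg w\<^esup>\<close>, so equality of
  group words becomes equality after multiplying crosswise by powers of the central element \<open>\<Delta>\<close>.\<close>

lemma pres_rel_word_eq:
  assumes "(a, b) \<in> pres_rel U R"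
  shows "g.word_eq (replicate (neg b) g.\<Delta> @ a) (replicate (neg a) g.\<Delta> @ b)"
  using assms
proof (induction rule: pres_rel.induct)
  have D: "g.\<Delta> \<in> UNIV \<times> U" using e_in by (simp add: sbar_def)
  {
    case (refl a)
    then show ?case using D by (intro g.word_eq.refl) (auto simp: words_def)
  next
    case (sym a b)
    from sym.IH show ?case by (rule g.word_eq.sym)
  next
    case (trans a b c)
    let ?D = "\<lambda>n. replicate n g.\<Delta>"
    have DD: "?D i @ ?D j @ w = ?D j @ ?D i @ w" for i j w
      by (simp add: replicate_add[symmetric] add.commute flip: append_assoc)
    have L: "?D n \<in> lists (UNIV \<times> U)" for n using D by auto
    \<comment> \<open>Both equalities are multiplied by further powers of \<open>\<Delta>\<close> to
      meet at \<open>b\<close>; the surplus \<open>neg b\<close> copies are cancelled at the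
      end.\<close>
    have "g.word_eq (?D (neg b) @ ?D (neg c) @ a) (?D (neg c) @ ?D (neg a) @ b)"
      using g.word_eq_append1[OF trans.IH(1) L] by (subst DD)
    also have "g.word_eq (?D (neg c) @ ?D (neg a) @ b) (?D (neg a) @ ?D (neg b) @ c)"
      using g.word_eq_append1[OF trans.IH(2) L] by (subst DD)
    also have "?D (neg a) @ ?D (neg b) @ c = ?D (neg b) @ ?D (neg a) @ c" by (rule DD)
    finally show ?case by (rule g.word_eq_cancel_Deltas)
  next
    case (cancel a b x s)
    let ?p = "replicate (neg (a @ b)) g.\<Delta> @ a"
    have p: "?p \<in> lists (UNIV \<times> U)" and b: "b \<in> lists (UNIV \<times> U)"
      and x: "(s, x) \<in> UNIV \<times> U"
      using cancel D by (auto simp: words_def)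
    have "smul m (s, x) (\<not> s, x) = Some g.\<Delta>"
      using g.one_bar[OF x] by (simp add: sbar_def)
    from g.word_eq_append1[OF g.word_eq.mult[OF this b] p]
    have "g.word_eq (?p @ [(s, x), (\<not> s, x)] @ b) (?p @ g.\<Delta> # b)" by simp
    \<comment> \<open>The cancelled pair contains exactly one negative letter, so the other side
      starts with one more \<open>\<Delta>\<close>; centrality moves the product of the pair
      there.\<close>
    also have "g.word_eq (?p @ g.\<Delta> # b) (g.\<Delta> # ?p @ b)"
      using p b by (rule g.word_eq_append_Delta)
    finally show ?case by (cases s) simp_all
  next
    case (relation a b r s)
    then obtain u v w where rs: "r = [(True, u), (True, v)]" "s = [(True, w)]" "m u v = Some w"
      by (auto simp: mult_relations_def)
    let ?p = "replicate (neg (a @ b)) g.\<Delta> @ a"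
    have p: "?p \<in> lists (UNIV \<times> U)" and b: "b \<in> lists (UNIV \<times> U)"
      using relation D by (auto simp: words_def)
    have "smul m (True, u) (True, v) = Some (True, w)" using rs by (simp add: smul_iff)
    from g.word_eq_append1[OF g.word_eq.mult[OF this b] p] show ?case by (simp add: rs)
  }
qed

section \<open>Classes of group words\<close>

definition cls where "cls w = pres_rel U R `` {w}"

lemma cls_eq: "(v, w) \<in> pres_rel U R \<Longrightarrow> cls v = cls w"
  unfolding cls_def by (rule equiv_class_eq[OF equiv_pres_rel])

lemma cls_eqD: "cls v = cls w \<Longrightarrow> w \<in> words U \<Longrightarrow> (v, w) \<in> pres_rel U R"
  unfolding cls_def by (rule eq_equiv_class[OF _ equiv_pres_rel])

lemma cls_in: "w \<in> words U \<Longrightarrow> cls w \<in> carrier (mult_group U m)"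
  by (auto simp: cls_def mult_group_def presented_group_def quotient_def)

lemma cls_mult: "\<lbrakk>v \<in> words U; w \<in> words U\<rbrakk> \<Longrightarrow> cls v \<otimes>\<^bsub>mult_group U m\<^esub> cls w = cls (v @ w)"
  unfolding cls_def mult_group_def by (rule presented_group_mult)

lemma cls_Nil: "cls [] = \<one>\<^bsub>mult_group U m\<^esub>"
  by (simp add: cls_def mult_group_def presented_group_def)

lemma group_mult_group: "group (mult_group U m)"
  unfolding mult_group_def by (rule group_presented_group)

lemma cls_cancel: "x \<in> U \<Longrightarrow> cls [(s, x), (\<not> s, x)] = cls []"
  using cls_eq[OF pres_rel.cancel[of "[]" U "[]" x s R]] by (simp add: words_def)

lemma cls_relation: "m u v = Some w \<Longrightarrow> cls [(True, u), (True, v)] = cls [(True, w)]"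
  using cls_eq[OF pres_rel.relation[of "[]" U "[]" "[(True, u), (True, v)]" "[(True, w)]" R]] closed
  by (auto simp: words_def mult_relations_def)

text \<open>The relation \<open>e e = e\<close> makes the class of \<open>e\<close> idempotent,
  hence trivial in a group.\<close>

lemma cls_e: "cls [(s, e)] = cls []"
proof -
  interpret G: group "mult_group U m" by (rule group_mult_group)
  have w: "[(t, e)] \<in> words U" for t using e_in by (simp add: words_def)
  have "cls [(True, e)] \<otimes>\<^bsub>mult_group U m\<^esub> cls [(True, e)] = cls [(True, e)]"
    using cls_mult[OF w w] cls_relation[OF left_id[OF e_in]] by simp
  then have T: "cls [(True, e)] = \<one>\<^bsub>mult_group U m\<^esub>"
    using cls_in[OF w] by (simp only: G.l_cancel_one)
  have "cls [(True, e)] \<otimes>\<^bsub>mult_group U m\<^esub> cls [(False, e)] = \<one>\<^bsub>mult_group U m\<^esub>"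
    using cls_mult[OF w w] cls_cancel[OF e_in, of True] by (simp add: cls_Nil)
  with T have "cls [(False, e)] = \<one>\<^bsub>mult_group U m\<^esub>" using cls_in[OF w] by simp
  with T show ?thesis by (cases s) (simp_all add: cls_Nil)
qed

lemma cls_inv:
  assumes "u \<in> U"
  shows "cls [(False, u)] = inv\<^bsub>mult_group U m\<^esub> cls [(True, u)]"
proof -
  interpret G: group "mult_group U m" by (rule group_mult_group)
  have w: "[(t, u)] \<in> words U" for t using assms by (simp add: words_def)
  have "cls [(False, u)] \<otimes>\<^bsub>mult_group U m\<^esub> cls [(True, u)] = \<one>\<^bsub>mult_group U m\<^esub>"
    using cls_mult[OF w w] cls_cancel[OF assms, of False] by (simp add: cls_Nil)
  from G.inv_equality[OF this cls_in[OF w] cls_in[OF w]] show ?thesis by simp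
qed

text \<open>Every product in the germ is a relation of the presentation, rearranged by
  inversion.\<close>

lemma cls_smul:
  assumes "smul m x y = Some z"
  shows "cls [z] = cls [x] \<otimes>\<^bsub>mult_group U m\<^esub> cls [y]"
proof -
  interpret G: group "mult_group U m" by (rule group_mult_group)
  define c where "c u = cls [(True, u)]" for u
  have c_in: "c u \<in> carrier (mult_group U m)" if "u \<in> U" for u
    unfolding c_def using that by (intro cls_in) (simp add: words_def)
  have c_mult: "c w = c u \<otimes>\<^bsub>mult_group U m\<^esub> c v" if "m u v = Some w" for u v w
    using cls_relation[OF that] cls_mult[of "[(True, u)]" "[(True, v)]"] closed[OF that]
    by (simp add: c_def words_def)
  obtain s u t v r w where x: "x = (s, u)" "y = (t, v)" "z = (r, w)" by (metis surj_pair)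
  have U: "u \<in> U" "v \<in> U" "w \<in> U" using g.closed[OF assms] x by auto
  note carr = c_in[OF U(1)] c_in[OF U(2)] c_in[OF U(3)]
  consider "s" "t" "r" "m u v = Some w" | "s" "\<not> t" "\<not> r" "m w u = Some v"
    | "\<not> s" "t" "\<not> r" "m v w = Some u"
    using assms unfolding x by (cases s; cases t) (auto simp: smul_iff)
  then show ?thesis
  proof cases
    case 1
    with x show ?thesis using c_mult by (simp add: c_def)
  next
    case 2
    have "inv\<^bsub>mult_group U m\<^esub> c w = c u \<otimes>\<^bsub>mult_group U m\<^esub> inv\<^bsub>mult_group U m\<^esub> c v"
      unfolding c_mult[OF 2(4)] using carr by (simp add: G.inv_mult_group G.m_assoc[symmetric])
    with 2 x U show ?thesis by (simp add: cls_inv c_def)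
  next
    case 3
    have "inv\<^bsub>mult_group U m\<^esub> c w = inv\<^bsub>mult_group U m\<^esub> c u \<otimes>\<^bsub>mult_group U m\<^esub> c v"
      unfolding c_mult[OF 3(4)] using carr by (simp add: G.inv_mult_group G.m_assoc)
    with 3 x U show ?thesis by (simp add: cls_inv c_def)
  qed
qed

section \<open>The embedding into the product with the integers\<close>

definition letter where "letter x = (cls [x], if fst x then 0 else 1 :: int)"

abbreviation GZ where "GZ \<equiv> mult_group U m \<times>\<times> integer_group"

lemma letter_val:
  "w \<in> words U \<Longrightarrow> foldr (\<lambda>x g. letter x \<otimes>\<^bsub>GZ\<^esub> g) w \<one>\<^bsub>GZ\<^esub> = (cls w, int (neg w))"
proof (induction w)
  case Nil
  then show ?case by (simp add: cls_Nil)
next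
  case (Cons x w)
  then have "[x] \<in> words U" "w \<in> words U" by (auto simp: words_def)
  with Cons show ?case by (cases x) (auto simp: letter_def cls_mult)
qed

text \<open>For faithfulness, equal values give equal classes and equal counts \<open>neg\<close>.
  Then \<open>pres_rel_word_eq\<close> yields equality after multiplication by the same power of
  \<open>\<Delta>\<close>, which cancels.\<close>

lemma letter_embedding: "garside_embedding (UNIV \<times> U) (smul m) (True, e) sbar GZ letter"
proof -
  interpret GZ: group GZ
    by (intro DirProd_group group_mult_group group_integer_group)
  have w: "[(s, u)] \<in> words U" if "u \<in> U" for s u using that by (simp add: words_def)
  show ?thesis
  proof
    fix x assume "x \<in> (UNIV :: bool set) \<times> U"
    then show "letter x \<in> carrier GZ" using w cls_in by (auto simp: letter_def)
  next
    fix x y z assume xyz: "smul m x y = Some z"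
    obtain s a t b r c where x: "x = (s, a)" "y = (t, b)" "z = (r, c)" by (metis surj_pair)
    show "letter z = letter x \<otimes>\<^bsub>GZ\<^esub> letter y"
      using cls_smul[OF xyz] xyz unfolding x by (cases s; cases t) (auto simp: letter_def smul_iff)
  next
    fix v w assume vw: "v \<in> lists ((UNIV :: bool set) \<times> U)" "w \<in> lists ((UNIV :: bool set) \<times> U)"
      "foldr (\<lambda>x g. letter x \<otimes>\<^bsub>GZ\<^esub> g) v \<one>\<^bsub>GZ\<^esub> = foldr (\<lambda>x g. letter x \<otimes>\<^bsub>GZ\<^esub> g) w \<one>\<^bsub>GZ\<^esub>"
    then have v: "v \<in> words U" "w \<in> words U" by (simp_all add: words_def)
    have "cls v = cls w" "neg v = neg w"
      using vw(3) unfolding v[THEN letter_val] by simp_all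
    then show "g.word_eq v w"
      using pres_rel_word_eq[OF cls_eqD[OF _ v(2)]] g.word_eq_cancel_Deltas by metis
  qed
qed

text \<open>Inverses of positive letters give every \<open>(cls w, 0)\<close>, while
  \<open>letter (False, e)\<close> is \<open>(\<one>, 1)\<close> and generates the integer
  factor.\<close>

lemma generate_letters: "generate GZ (letter ` (UNIV \<times> U)) = carrier GZ"
proof
  interpret G: group "mult_group U m" by (rule group_mult_group)
  interpret GZ: group GZ
    by (intro DirProd_group group_mult_group group_integer_group)
  interpret emb: garside_embedding "UNIV \<times> U" "smul m" "(True, e)" sbar GZ letter
    by (rule letter_embedding)
  let ?H = "generate GZ (letter ` (UNIV \<times> U))"
  have letters: "letter ` (UNIV \<times> U) \<subseteq> carrier GZ" using emb.\<iota>_in by blast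
  show "?H \<subseteq> carrier GZ" by (rule GZ.generate_incl[OF letters])
  have w: "[(s, u)] \<in> words U" if "u \<in> U" for s u using that by (simp add: words_def)
  have gen: "letter (s, u) \<in> ?H" if "u \<in> U" for s u
    using that by (intro generate.incl) auto
  have inv: "inv\<^bsub>GZ\<^esub> a \<in> ?H" if "a \<in> ?H" for a
    using GZ.generate_m_inv_closed[OF letters that] .
  have single: "(cls [(s, u)], 0) \<in> ?H" if u: "u \<in> U" for s u
  proof (cases s)
    case True
    with gen[OF u, of True] show ?thesis by (simp add: letter_def)
  next
    case False
    have "(cls [(False, u)], 0) \<otimes>\<^bsub>GZ\<^esub> letter (True, u) = \<one>\<^bsub>GZ\<^esub>"
      using cls_cancel[OF u, of False] cls_mult[OF w w] u by (simp add: letter_def cls_Nil)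
    then have "inv\<^bsub>GZ\<^esub> letter (True, u) = (cls [(False, u)], 0)"
      by (rule GZ.inv_equality) (use u w cls_in letter_def in \<open>auto simp: letter_def\<close>)
    with inv[OF gen[OF u, of True]] False show ?thesis by simp
  qed
  have word: "(cls w, 0) \<in> ?H" if "w \<in> words U" for w
    using that
  proof (induction w)
    case Nil
    then show ?case using generate.one[of GZ] by (simp add: cls_Nil)
  next
    case (Cons x w)
    then have x: "[x] \<in> words U" "w \<in> words U" by (auto simp: words_def)
    then have "(cls [x], 0) \<in> ?H" using single by (cases x) (auto simp: words_def)
    with Cons x have "(cls [x], 0) \<otimes>\<^bsub>GZ\<^esub> (cls w, 0) \<in> ?H" by (intro generate.eng) auto
    with x show ?case by (simp add: cls_mult)
  qed
  have D: "(\<one>\<^bsub>mult_group U m\<^esub>, 1) \<in> ?H"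
    using gen[OF e_in, of False] by (simp add: letter_def cls_e cls_Nil)
  have "inv\<^bsub>GZ\<^esub> (\<one>\<^bsub>mult_group U m\<^esub>, 1) = (\<one>\<^bsub>mult_group U m\<^esub>, -1)"
    by (rule GZ.inv_equality) auto
  with inv[OF D] have D': "(\<one>\<^bsub>mult_group U m\<^esub>, -1) \<in> ?H" by simp
  have int: "(\<one>\<^bsub>mult_group U m\<^esub>, k) \<in> ?H" for k
  proof (induction k rule: int_induct[of _ 0])
    case base
    show ?case using generate.one[of GZ] by simp
  next
    case (step1 i)
    from generate.eng[OF step1(2) D] show ?case by simp
  next
    case (step2 i)
    from generate.eng[OF step2(2) D'] show ?case by simp
  qed
  show "carrier GZ \<subseteq> ?H"
  proof
    fix a assume "a \<in> carrier GZ"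
    then obtain A k where a: "a = (A, k)" "A \<in> carrier (mult_group U m)" by auto
    then obtain w where w: "w \<in> words U" "A = cls w"
      by (auto simp: mult_group_def presented_group_def cls_def elim!: quotientE)
    from generate.eng[OF word[OF w(1)] int[of k]] show "a \<in> ?H"
      using a w cls_in by simp
  qed
qed

theorem garside_group_mult_group: "garside_group GZ (mult_group_gen U m e, 1)"
proof -
  interpret emb: garside_embedding "UNIV \<times> U" "smul m" "(True, e)" sbar GZ letter
    by (rule letter_embedding)
  \<comment> \<open>The germ has \<open>\<Delta> = (False, e)\<close>, the formal inverse of
    \<open>e\<close>; both signs of \<open>e\<close> have the trivial class.\<close>
  have "letter (sbar (True, e)) = (mult_group_gen U m e, 1)"
    using cls_e[of True] cls_e[of False] by (simp add: letter_def sbar_def mult_group_gen_def cls_def)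
  with emb.garside_groupI[OF generate_letters] show ?thesis by simp
qed

end

section \<open>Translation of the order-theoretic hypotheses\<close>

lemma prefix_order_simps [simp]:
  "carrier (prefix_order U m) = U" "(.=\<^bsub>prefix_order U m\<^esub>) = (=)"
  by (simp_all add: prefix_order_def)

lemma suffix_order_eq: "suffix_order U m = prefix_order U (\<lambda>x y. m y x)"
  by (simp add: suffix_order_def prefix_order_def)

lemma (in positive_partial_mult) prefix_order_le: "x \<sqsubseteq>\<^bsub>prefix_order U m\<^esub> y \<longleftrightarrow> pdiv m x y"
  using closed by (auto simp: prefix_order_def pdiv_def)

lemma (in positive_partial_mult) is_join_iff:
  assumes "u \<in> U" "v \<in> U"
  shows "is_join (prefix_order U m) u v w \<longleftrightarrow> pjoin m u v w"
  using assms pdiv_in by (auto simp: is_join_def least_def Upper_def prefix_order_le pjoin_def)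

lemma (in positive_partial_mult) lower_semilattice_meet:
  assumes "lower_semilattice (prefix_order U m)" "x \<in> U" "y \<in> U"
  shows "\<exists>z. pdiv m z x \<and> pdiv m z y \<and> (\<forall>t. pdiv m t x \<longrightarrow> pdiv m t y \<longrightarrow> pdiv m t z)"
proof -
  interpret lower_semilattice "prefix_order U m" by (rule assms)
  from inf_of_two_exists[of x y] assms show ?thesis
    using pdiv_in by (auto simp: greatest_def Lower_def prefix_order_le)
qed

theorem theorem1:
  fixes U :: "'a set" and m :: "'a \<Rightarrow> 'a \<Rightarrow> 'a option" and e :: 'a
  assumes "finite U"
    and "positive_partial_mult U m e"
    and "lower_semilattice (prefix_order U m)"
    and "lower_semilattice (suffix_order U m)"
    and "\<And>a u v w. \<lbrakk>a \<in> U; u \<in> U; v \<in> U; w \<in> U; m a u \<noteq> None; m a v \<noteq> None;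
           is_join (prefix_order U m) u v w\<rbrakk> \<Longrightarrow> m a w \<noteq> None"
    and "\<And>a u v w. \<lbrakk>a \<in> U; u \<in> U; v \<in> U; w \<in> U; m u a \<noteq> None; m v a \<noteq> None;
           is_join (suffix_order U m) u v w\<rbrakk> \<Longrightarrow> m w a \<noteq> None"
    and "\<And>a b u v. \<lbrakk>a \<in> U; b \<in> U; u \<in> U; v \<in> U;
           m a u \<noteq> None; m a v \<noteq> None; m b u \<noteq> None; m b v \<noteq> None\<rbrakk> \<Longrightarrow>
           (\<exists>w. is_join (suffix_order U m) a b w) \<or> (\<exists>w. is_join (prefix_order U m) u v w)"
  shows "garside_group (mult_group U m \<times>\<times> integer_group) (mult_group_gen U m e, 1)"
proof -
  interpret positive_partial_mult U m e by (rule assms(2))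
  interpret f: positive_partial_mult U "\<lambda>x y. m y x" e by (rule flip)
  have defined: "a \<in> U \<and> b \<in> U" if "m a b \<noteq> None" for a b
    using that closed by blast
  have "interlocked_partial_mult U m e"
  proof
    show "finite U" by (rule assms(1))
    show "\<exists>z. pdiv m z x \<and> pdiv m z y \<and> (\<forall>t. pdiv m t x \<longrightarrow> pdiv m t y \<longrightarrow> pdiv m t z)"
      if "x \<in> U" "y \<in> U" for x y
      using assms(3) that by (rule lower_semilattice_meet)
    show "\<exists>z. pdiv (\<lambda>x y. m y x) z x \<and> pdiv (\<lambda>x y. m y x) z y \<and>
        (\<forall>t. pdiv (\<lambda>x y. m y x) t x \<longrightarrow> pdiv (\<lambda>x y. m y x) t y \<longrightarrow> pdiv (\<lambda>x y. m y x) t z)"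
      if "x \<in> U" "y \<in> U" for x y
      using assms(4) that unfolding suffix_order_eq by (rule f.lower_semilattice_meet)
    show "m a w \<noteq> None" if "m a u \<noteq> None" "m a v \<noteq> None" "pjoin m u v w" for a u v w
    proof -
      have "a \<in> U" "u \<in> U" "v \<in> U" "w \<in> U"
        using that defined pdiv_in unfolding pjoin_def by blast+
      with assms(5) is_join_iff that show ?thesis by blast
    qed
    show "m w a \<noteq> None" if "m u a \<noteq> None" "m v a \<noteq> None" "pjoin (\<lambda>x y. m y x) u v w" for a u v w
    proof -
      have "a \<in> U" "u \<in> U" "v \<in> U" "w \<in> U"
        using that defined f.pdiv_in unfolding pjoin_def by blast+
      with assms(6)[unfolded suffix_order_eq] f.is_join_iff that show ?thesis by blast
    qed
    show "(\<exists>w. pjoin (\<lambda>x y. m y x) a b w) \<or> (\<exists>w. pjoin m u v w)"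
      if d: "m a u \<noteq> None" "m a v \<noteq> None" "m b u \<noteq> None" "m b v \<noteq> None" for a b u v
    proof -
      have "a \<in> U" "b \<in> U" "u \<in> U" "v \<in> U" using d defined by blast+
      then show ?thesis
        using assms(7)[unfolded suffix_order_eq, of a b u v] d by (simp add: is_join_iff f.is_join_iff)
    qed
  qed
  then show ?thesis by (rule interlocked_partial_mult.garside_group_mult_group)
qed

end
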